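(* Let $(\mathcal M,g)$ be a (complex, four-dimensional) hyper-Kähler space which admits a hidden symmetry, i.e. $\mathcal M$ embeds into a solution of the level-$n$ hyper-Kähler hierarchy ($n\ge 1$) that admits a non-zero symmetry. Then $\mathcal M$ admits a not identically vanishing spinor field $K^{B}_{A'_2\cdots A'_{2n}}$, symmetric in its $2n-1$ primed indices, satisfying $$\nabla^{(A}_{(A'_1}K^{B)}_{A'_2\cdots A'_{2n})}=0 .$$
   Context: All considerations are local and holomorphic. A space-time is a complex 4-manifold $\mathcal M$ with holomorphic metric $g$ and compatible volume form; $T\mathcal M=S^A\otimes S^{A'}$ with $S^A,S^{A'}$ rank-two spin bundles carrying symplectic forms $\varepsilon_{AB},\varepsilon_{A'B'}$ whose product gives the metric (Penrose–Rindler conventions); $\nabla_{AA'}$ is the Levi-Civita connection; round brackets denote symmetrisation. Hyper-Kähler means that the Ricci tensor vanishes and the self-dual Weyl spinor $C_{A'B'C'D'}$ vanishes (equivalently, the connection on primed spinors is flat). Locally such metrics have the form $g=2dw\,dx+2dz\,dy-2\Theta_{xx}dz^2-2\Theta_{yy}dw^2+4\Theta_{xy}dw\,dz$ with $\Theta_{xw}+\Theta_{yz}+\Theta_{xx}\Theta_{yy}-\Theta_{xy}^2=0$. Level-$n$ hyper-Kähler hierarchy: let $\mathcal N$ have coordinates $x^{Ai}$, $A=0,1$, $i=0,\dots,n$, with $\partial_{Ai}=\partial/\partial x^{Ai}$. A solution is a function $\Theta(x^{Ai})$ with $$\partial_{Ai}\partial_{B\,j-1}\Theta-\partial_{Bj}\partial_{A\,i-1}\Theta+\{\partial_{A\,i-1}\Theta,\partial_{B\,j-1}\Theta\}_{yx}=0,\qquad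 i,j=1,\dots,n,$$ where $y=x^{00}$, $x=-x^{10}$ and $\{f,h\}_{yx}=f_yh_x-f_xh_y$; also write $w=x^{01}$, $z=x^{11}$. The slices $x^{Ai}=$ const., $i\ge2$, are hyper-Kähler 4-manifolds with the metric $g=2dw\,dx+2dz\,dy-2\Theta_{xx}dz^2-2\Theta_{yy}dw^2+4\Theta_{xy}dw\,dz$; $\mathcal M$ embeds into the hierarchy if it is such a slice. Let $\pi_{A'}=(\pi_{0'},\pi_{1'})$ be fibre coordinates on the primed spin bundle $\mathcal N\times\mathbb C^2$, $\lambda=\pi_{0'}/\pi_{1'}$. The hierarchy has twistor functions, homogeneous of degree $n$ in $\pi_{A'}$, $$\omega^0=\pi_{1'}^n\Big[\sum_{i=0}^n\lambda^{n-i}x^{0i}+\sum_{i=0}^n\lambda^{n+1+i}\partial_{1i}\Theta+\cdots\Big],\quad \omega^1=\pi_{1'}^n\Big[\sum_{i=0}^n\lambda^{n-i}x^{1i}-\sum_{i=0}^n\lambda^{n+1+i}\partial_{0i}\Theta+\cdots\Big],$$ and $\Sigma=d\omega^0\wedge d\omega^1$ ($\pi_{A'}$ held constant) truncates after $\lambda^{2n}$, so it is a 2-form that is a homogeneous polynomial of degree $2n$ in $\pi_{A'}$. The solution admits a symmetry if there is a vector field $K$ on $\mathcal N$ with a lift $\tilde K=K+\phi^{A'}_{B'}\pi_{A'}\,\partial/\partial\pi_{B'}$ to the primed spin bundle such that $\mathcal L_{\tilde K}\Sigma=0$. *)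

theory Defs
  imports "HOL-Analysis.Analysis" "HOL-Combinatorics.Permutations"
begin

text \<open>
  Conventions. Spinor indices, unprimed and primed, are elements \<open>0, 1\<close> of the two-element
  type \<open>2\<close>; a component of a spinor field with several symmetric primed indices is
  addressed by the list of those indices.
  A coordinate of the hierarchy space \<open>\<N>\<close> is a pair \<open>(A, \<iota> i)\<close>, where the labelling \<open>\<iota>\<close> maps
  \<open>{0..n}\<close> bijectively onto a finite type \<open>'m\<close> (so \<open>\<N>\<close> is an open subset of
  \<open>complex ^ (2 \<times> 'm)\<close>, of dimension \<open>2 (n + 1)\<close>). The coordinates of the four-manifold \<open>\<M>\<close>
  are the pairs \<open>(A, i) :: 2 \<times> 2\<close>.
\<close>


section \<open>Holomorphic functions of several variables\<close>

definition holo_on :: "(complex ^ 'k::finite \<Rightarrow> complex) \<Rightarrow> (complex ^ 'k) set \<Rightarrow> bool" where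
  "holo_on f U \<longleftrightarrow>
     (\<forall>x\<in>U. \<exists>f'. (f has_derivative f') (at x) \<and> (\<forall>c v. f' (c *s v) = c * f' v))"

definition pd :: "'k \<Rightarrow> (complex ^ 'k::finite \<Rightarrow> complex) \<Rightarrow> complex ^ 'k \<Rightarrow> complex" where
  "pd k f x = deriv (\<lambda>t. f (x + t *s axis k 1)) 0"


section \<open>The hierarchy\<close>

text \<open>Here \<open>y = x\<^sup>0\<^sup>0\<close> and \<open>x = - x\<^sup>1\<^sup>0\<close>, hence the sign in \<open>\<partial>\<^sub>x\<close>; \<open>l\<close> is the label of the
  second index \<open>0\<close>.\<close>

definition dY :: "'m \<Rightarrow> (complex ^ (2 \<times> 'm::finite) \<Rightarrow> complex) \<Rightarrow> complex ^ (2 \<times> 'm) \<Rightarrow> complex" where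
  "dY l f p = pd (0, l) f p"

definition dX :: "'m \<Rightarrow> (complex ^ (2 \<times> 'm::finite) \<Rightarrow> complex) \<Rightarrow> complex ^ (2 \<times> 'm) \<Rightarrow> complex" where
  "dX l f p = - pd (1, l) f p"

definition poisson_yx ::
  "'m \<Rightarrow> (complex ^ (2 \<times> 'm::finite) \<Rightarrow> complex) \<Rightarrow> (complex ^ (2 \<times> 'm) \<Rightarrow> complex)
    \<Rightarrow> complex ^ (2 \<times> 'm) \<Rightarrow> complex" where
  "poisson_yx l f h p = dY l f p * dX l h p - dX l f p * dY l h p"

definition hierarchy_solution ::
  "nat \<Rightarrow> (nat \<Rightarrow> 'm::finite) \<Rightarrow> (complex ^ (2 \<times> 'm)) set \<Rightarrow> (complex ^ (2 \<times> 'm) \<Rightarrow> complex) \<Rightarrow> bool" where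
  "hierarchy_solution n \<iota> U \<Theta> \<longleftrightarrow>
     holo_on \<Theta> U \<and>
     (\<forall>p\<in>U. \<forall>A B. \<forall>i\<in>{1..n}. \<forall>j\<in>{1..n}.
        pd (A, \<iota> i) (pd (B, \<iota> (j - 1)) \<Theta>) p - pd (B, \<iota> j) (pd (A, \<iota> (i - 1)) \<Theta>) p
        + poisson_yx (\<iota> 0) (pd (A, \<iota> (i - 1)) \<Theta>) (pd (B, \<iota> (j - 1)) \<Theta>) p = 0)"


section \<open>Twistor functions and symmetries\<close>

text \<open>\<open>tw_coeff n \<iota> \<Theta> A k\<close> is the coefficient of \<open>\<lambda>\<^sup>k\<close> in \<open>\<omega>\<^sup>A / \<pi>\<^sub>1\<^sub>'\<^sup>n\<close>, for \<open>k \<le> 2 n + 1\<close>: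
  \<open>\<lambda>\<^sup>n\<^sup>-\<^sup>i\<close> comes with \<open>x\<^sup>A\<^sup>i\<close>, and \<open>\<lambda>\<^sup>n\<^sup>+\<^sup>1\<^sup>+\<^sup>i\<close> with \<open>\<partial>\<^sub>1\<^sub>i \<Theta>\<close> (for \<open>A = 0\<close>) or
  \<open>- \<partial>\<^sub>0\<^sub>i \<Theta>\<close> (for \<open>A = 1\<close>), \<open>0 \<le> i \<le> n\<close>.\<close>

definition tw_coeff ::
  "nat \<Rightarrow> (nat \<Rightarrow> 'm::finite) \<Rightarrow> (complex ^ (2 \<times> 'm) \<Rightarrow> complex) \<Rightarrow> 2 \<Rightarrow> nat
    \<Rightarrow> complex ^ (2 \<times> 'm) \<Rightarrow> complex" where
  "tw_coeff n \<iota> \<Theta> A k p =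
     (if k \<le> n then p $ (A, \<iota> (n - k))
      else if A = 0 then pd (1, \<iota> (k - (n + 1))) \<Theta> p
      else - pd (0, \<iota> (k - (n + 1))) \<Theta> p)"

text \<open>The coefficient of \<open>\<lambda>\<^sup>k\<close> in \<open>d\<omega>\<^sup>0 \<and> d\<omega>\<^sup>1\<close> involves only the coefficients of order at most
  \<open>k\<close> of \<open>\<omega>\<^sup>0\<close> and \<open>\<omega>\<^sup>1\<close>. As \<open>d\<omega>\<^sup>0 \<and> d\<omega>\<^sup>1\<close> has no terms beyond \<open>\<lambda>\<^sup>2\<^sup>n\<close>, the terms of the
  twistor functions of order \<open>\<ge> 2 n + 2\<close> do not enter. Two-forms are given by their components,
  with \<open>(\<alpha> \<and> \<beta>)\<^sub>a\<^sub>b = \<alpha>\<^sub>a \<beta>\<^sub>b - \<alpha>\<^sub>b \<beta>\<^sub>a\<close>.\<close>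

definition Sigma_coeff ::
  "nat \<Rightarrow> (nat \<Rightarrow> 'm::finite) \<Rightarrow> (complex ^ (2 \<times> 'm) \<Rightarrow> complex) \<Rightarrow> nat
    \<Rightarrow> complex ^ (2 \<times> 'm) \<Rightarrow> 2 \<times> 'm \<Rightarrow> 2 \<times> 'm \<Rightarrow> complex" where
  "Sigma_coeff n \<iota> \<Theta> k p a b =
     (\<Sum>j\<le>k. pd a (tw_coeff n \<iota> \<Theta> 0 j) p * pd b (tw_coeff n \<iota> \<Theta> 1 (k - j)) p
           - pd b (tw_coeff n \<iota> \<Theta> 0 j) p * pd a (tw_coeff n \<iota> \<Theta> 1 (k - j)) p)"

text \<open>\<open>\<Sigma>\<close> at fibre coordinates \<open>\<pi> = (\<pi>\<^sub>0\<^sub>', \<pi>\<^sub>1\<^sub>')\<close>, multiplied out with \<open>\<lambda> = \<pi>\<^sub>0\<^sub>' / \<pi>\<^sub>1\<^sub>'\<close>.\<close>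

definition Sigma_form ::
  "nat \<Rightarrow> (nat \<Rightarrow> 'm::finite) \<Rightarrow> (complex ^ (2 \<times> 'm) \<Rightarrow> complex) \<Rightarrow> complex ^ 2
    \<Rightarrow> complex ^ (2 \<times> 'm) \<Rightarrow> 2 \<times> 'm \<Rightarrow> 2 \<times> 'm \<Rightarrow> complex" where
  "Sigma_form n \<iota> \<Theta> \<pi> p a b =
     (\<Sum>k\<le>2 * n. (\<pi> $ 0) ^ k * (\<pi> $ 1) ^ (2 * n - k) * Sigma_coeff n \<iota> \<Theta> k p a b)"

definition lie_2form ::
  "(complex ^ 'k::finite \<Rightarrow> complex ^ 'k) \<Rightarrow> (complex ^ 'k \<Rightarrow> 'k \<Rightarrow> 'k \<Rightarrow> complex)
    \<Rightarrow> complex ^ 'k \<Rightarrow> 'k \<Rightarrow> 'k \<Rightarrow> complex" where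
  "lie_2form K \<sigma> p a b =
     (\<Sum>c\<in>UNIV. K p $ c * pd c (\<lambda>q. \<sigma> q a b) p
              + \<sigma> p c b * pd a (\<lambda>q. K q $ c) p
              + \<sigma> p a c * pd b (\<lambda>q. K q $ c) p)"

text \<open>The Lie derivative of \<open>\<Sigma>\<close> along the lift
  \<open>K + \<phi>\<^sup>A\<^sup>'\<^sub>B\<^sub>' \<pi>\<^sub>A\<^sub>' \<partial>/\<partial>\<pi>\<^sub>B\<^sub>'\<close>. Since \<open>\<Sigma>\<close> has no \<open>d\<pi>\<close> components and \<open>K\<close> does not depend on \<open>\<pi>\<close>,
  the Lie derivative has no \<open>d\<pi>\<close> components either, and these are all its components, even when
  \<open>\<phi>\<close> is not constant. The first index argument of \<open>\<phi>\<close> is the upper one.\<close>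

definition lie_lift_Sigma ::
  "nat \<Rightarrow> (nat \<Rightarrow> 'm::finite) \<Rightarrow> (complex ^ (2 \<times> 'm) \<Rightarrow> complex)
    \<Rightarrow> (complex ^ (2 \<times> 'm) \<Rightarrow> complex ^ (2 \<times> 'm)) \<Rightarrow> (complex ^ (2 \<times> 'm) \<Rightarrow> 2 \<Rightarrow> 2 \<Rightarrow> complex)
    \<Rightarrow> complex ^ 2 \<Rightarrow> complex ^ (2 \<times> 'm) \<Rightarrow> 2 \<times> 'm \<Rightarrow> 2 \<times> 'm \<Rightarrow> complex" where
  "lie_lift_Sigma n \<iota> \<Theta> K \<phi> \<pi> p a b =
     lie_2form K (Sigma_form n \<iota> \<Theta> \<pi>) p a b
     + (\<Sum>A'\<in>UNIV. \<Sum>B'\<in>UNIV.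
          \<phi> p A' B' * \<pi> $ A' * pd B' (\<lambda>\<rho>. Sigma_form n \<iota> \<Theta> \<rho> p a b) \<pi>)"

definition hierarchy_symmetry ::
  "nat \<Rightarrow> (nat \<Rightarrow> 'm::finite) \<Rightarrow> (complex ^ (2 \<times> 'm)) set \<Rightarrow> (complex ^ (2 \<times> 'm) \<Rightarrow> complex)
    \<Rightarrow> (complex ^ (2 \<times> 'm) \<Rightarrow> complex ^ (2 \<times> 'm)) \<Rightarrow> bool" where
  "hierarchy_symmetry n \<iota> U \<Theta> K \<longleftrightarrow>
     (\<forall>c. holo_on (\<lambda>p. K p $ c) U) \<and>
     (\<exists>\<phi>. (\<forall>A' B'. holo_on (\<lambda>p. \<phi> p A' B') U) \<and>
          (\<forall>p\<in>U. \<forall>\<pi> a b. lie_lift_Sigma n \<iota> \<Theta> K \<phi> \<pi> p a b = 0))"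


section \<open>Complex space-times and spinor fields\<close>

type_synonym point = "complex ^ (2 \<times> 2)"
type_synonym metric = "point \<Rightarrow> point \<Rightarrow> point \<Rightarrow> complex"
type_synonym vfield = "point \<Rightarrow> point"
type_synonym tetrad = "2 \<Rightarrow> 2 \<Rightarrow> vfield"
type_synonym spinor_field = "point \<Rightarrow> 2 \<Rightarrow> 2 list \<Rightarrow> complex"

definition metric_matrix :: "metric \<Rightarrow> point \<Rightarrow> complex ^ (2 \<times> 2) ^ (2 \<times> 2)" where
  "metric_matrix g p = (\<chi> a b. g p (axis a 1) (axis b 1))"

definition christoffel :: "metric \<Rightarrow> point \<Rightarrow> 2 \<times> 2 \<Rightarrow> 2 \<times> 2 \<Rightarrow> 2 \<times> 2 \<Rightarrow> complex" where
  "christoffel g p c a b =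
     (\<Sum>d\<in>UNIV. matrix_inv (metric_matrix g p) $ c $ d *
        (pd a (\<lambda>q. metric_matrix g q $ d $ b) p
         + pd b (\<lambda>q. metric_matrix g q $ d $ a) p
         - pd d (\<lambda>q. metric_matrix g q $ a $ b) p)) / 2"

definition levi_civita :: "metric \<Rightarrow> vfield \<Rightarrow> vfield \<Rightarrow> vfield" where
  "levi_civita g X Y p =
     (\<chi> c. (\<Sum>a\<in>UNIV. X p $ a * pd a (\<lambda>q. Y q $ c) p)
          + (\<Sum>a\<in>UNIV. \<Sum>b\<in>UNIV. christoffel g p c a b * X p $ a * Y p $ b))"

text \<open>Both \<open>\<epsilon>\<^sub>A\<^sub>B\<close> and \<open>\<epsilon>\<^sup>A\<^sup>B\<close>, and their primed versions.\<close>

definition eps :: "2 \<Rightarrow> 2 \<Rightarrow> complex" where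
  "eps A B = (if A = 0 \<and> B = 1 then 1 else if A = 1 \<and> B = 0 then - 1 else 0)"

text \<open>A tetrad \<open>e\<^sub>A\<^sub>A\<^sub>'\<close> with \<open>g(e\<^sub>A\<^sub>A\<^sub>', e\<^sub>B\<^sub>B\<^sub>') = \<epsilon>\<^sub>A\<^sub>B \<epsilon>\<^sub>A\<^sub>'\<^sub>B\<^sub>'\<close> identifies the tangent bundle with
  the tensor product of two spin bundles, trivialised by normalised spin frames.\<close>

definition null_tetrad_at :: "metric \<Rightarrow> tetrad \<Rightarrow> point \<Rightarrow> bool" where
  "null_tetrad_at g e p \<longleftrightarrow>
     (\<forall>A A' B B'. g p (e A A' p) (e B B' p) = eps A B * eps A' B')"

text \<open>The component \<open>v\<^sup>A\<^sup>A\<^sup>'\<close> of a vector \<open>v = v\<^sup>A\<^sup>A\<^sup>' e\<^sub>A\<^sub>A\<^sub>'\<close> in a null tetrad.\<close>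

definition tetrad_comp :: "metric \<Rightarrow> tetrad \<Rightarrow> point \<Rightarrow> point \<Rightarrow> 2 \<Rightarrow> 2 \<Rightarrow> complex" where
  "tetrad_comp g e p v A A' =
     (\<Sum>B\<in>UNIV. \<Sum>B'\<in>UNIV. eps A B * eps A' B' * g p v (e B B' p))"

text \<open>The Levi-Civita connection splits as \<open>\<nabla>\<^sub>A\<^sub>A\<^sub>' e\<^sub>B\<^sub>B\<^sub>' = \<Gamma>\<^sub>A\<^sub>A\<^sub>'\<^sub>B\<^sup>C e\<^sub>C\<^sub>B\<^sub>' + \<Gamma>'\<^sub>A\<^sub>A\<^sub>'\<^sub>B\<^sub>'\<^sup>C\<^sup>' e\<^sub>B\<^sub>C\<^sub>'\<close> with
  trace-free \<open>\<Gamma>\<close> and \<open>\<Gamma>'\<close> (that is, preserving \<open>\<epsilon>\<^sub>A\<^sub>B\<close> and \<open>\<epsilon>\<^sub>A\<^sub>'\<^sub>B\<^sub>'\<close>); taking the trace over the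
  other kind of index extracts the two spin connections.\<close>

definition spin_conn :: "metric \<Rightarrow> tetrad \<Rightarrow> point \<Rightarrow> 2 \<Rightarrow> 2 \<Rightarrow> 2 \<Rightarrow> 2 \<Rightarrow> complex" where
  "spin_conn g e p A A' B C =
     (\<Sum>B'\<in>UNIV. tetrad_comp g e p (levi_civita g (e A A') (e B B') p) C B') / 2"

definition spin_conn_primed :: "metric \<Rightarrow> tetrad \<Rightarrow> point \<Rightarrow> 2 \<Rightarrow> 2 \<Rightarrow> 2 \<Rightarrow> 2 \<Rightarrow> complex" where
  "spin_conn_primed g e p A A' B' C' =
     (\<Sum>B\<in>UNIV. tetrad_comp g e p (levi_civita g (e A A') (e B B') p) B C') / 2"

text \<open>\<open>\<nabla>\<^sub>A\<^sub>A\<^sub>' \<kappa>\<^sup>B\<^sub>L\<close> for a spinor field with one upper unprimed index \<open>B\<close> and a list \<open>L\<close> of lower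
  primed indices.\<close>

definition spinor_nabla ::
  "metric \<Rightarrow> tetrad \<Rightarrow> spinor_field \<Rightarrow> point \<Rightarrow> 2 \<Rightarrow> 2 \<Rightarrow> 2 \<Rightarrow> 2 list \<Rightarrow> complex" where
  "spinor_nabla g e \<kappa> p A A' B L =
     (\<Sum>a\<in>UNIV. e A A' p $ a * pd a (\<lambda>q. \<kappa> q B L) p)
     + (\<Sum>C\<in>UNIV. spin_conn g e p A A' C B * \<kappa> p C L)
     - (\<Sum>j<length L. \<Sum>C'\<in>UNIV. spin_conn_primed g e p A A' (L ! j) C' * \<kappa> p B (L[j := C']))"

text \<open>\<open>\<nabla>\<^sup>A\<^sub>A\<^sub>' \<kappa>\<^sup>B\<^sub>L\<close> for \<open>A' # L\<close>, with the index raised by \<open>\<nabla>\<^sup>A = \<epsilon>\<^sup>A\<^sup>C \<nabla>\<^sub>C\<close>.\<close>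

definition raised_nabla ::
  "metric \<Rightarrow> tetrad \<Rightarrow> spinor_field \<Rightarrow> point \<Rightarrow> 2 \<Rightarrow> 2 \<Rightarrow> 2 list \<Rightarrow> complex" where
  "raised_nabla g e \<kappa> p A B L =
     (\<Sum>C\<in>UNIV. eps A C * spinor_nabla g e \<kappa> p C (hd L) B (tl L))"

text \<open>Symmetrisation over the two unprimed indices and over all indices in the list \<open>L\<close>.\<close>

definition killing_op ::
  "metric \<Rightarrow> tetrad \<Rightarrow> spinor_field \<Rightarrow> point \<Rightarrow> 2 \<Rightarrow> 2 \<Rightarrow> 2 list \<Rightarrow> complex" where
  "killing_op g e \<kappa> p A B L =
     (\<Sum>s | s permutes {..<length L}.
        raised_nabla g e \<kappa> p A B (permute_list s L)
        + raised_nabla g e \<kappa> p B A (permute_list s L)) / (2 * fact (length L))"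

text \<open>A holomorphic spinor field \<open>\<kappa>\<^sup>B\<^sub>L\<close> on \<open>M\<close> with \<open>m\<close> symmetric lower primed indices.
  Values of \<open>\<kappa>\<close> on lists of other lengths are irrelevant.\<close>

definition sym_spinor_field :: "point set \<Rightarrow> nat \<Rightarrow> spinor_field \<Rightarrow> bool" where
  "sym_spinor_field M m \<kappa> \<longleftrightarrow>
     (\<forall>B L. length L = m \<longrightarrow> holo_on (\<lambda>p. \<kappa> p B L) M) \<and>
     (\<forall>p\<in>M. \<forall>B L s. length L = m \<and> s permutes {..<m} \<longrightarrow> \<kappa> p B (permute_list s L) = \<kappa> p B L)"


section \<open>The hyper-Kaehler slices\<close>

text \<open>The slice on which the coordinates \<open>x\<^sup>A\<^sup>i\<close>, \<open>i \<ge> 2\<close>, have the constant values given by \<open>c\<close>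
  (the components of \<open>c\<close> with \<open>i < 2\<close> are not used).\<close>

definition slice_emb ::
  "(nat \<Rightarrow> 'm::finite) \<Rightarrow> complex ^ (2 \<times> 'm) \<Rightarrow> point \<Rightarrow> complex ^ (2 \<times> 'm)" where
  "slice_emb \<iota> c p =
     (\<chi> a. if snd a = \<iota> 0 then p $ (fst a, 0)
           else if snd a = \<iota> 1 then p $ (fst a, 1)
           else c $ a)"

definition slice ::
  "(nat \<Rightarrow> 'm::finite) \<Rightarrow> complex ^ (2 \<times> 'm) \<Rightarrow> (complex ^ (2 \<times> 'm)) set \<Rightarrow> point set" where
  "slice \<iota> c U = {p. slice_emb \<iota> c p \<in> U}"

text \<open>The metric determined by \<open>\<theta>\<close> on the four-manifold with coordinates
  \<open>y = x\<^sup>0\<^sup>0\<close>, \<open>x = - x\<^sup>1\<^sup>0\<close>, \<open>w = x\<^sup>0\<^sup>1\<close>, \<open>z = x\<^sup>1\<^sup>1\<close>, polarised to a symmetric bilinear form.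
  If \<open>\<theta>\<close> is the restriction of a solution of the hierarchy to a slice, the equation with
  \<open>i = j = 1\<close>, \<open>A = 0\<close>, \<open>B = 1\<close> is the second heavenly equation for \<open>\<theta>\<close>, so the metric is
  hyper-Kaehler.\<close>

definition heavenly_metric :: "(point \<Rightarrow> complex) \<Rightarrow> metric" where
  "heavenly_metric \<theta> p u v =
     (let dw = (\<lambda>h::point. h $ (0, 1)); dz = (\<lambda>h::point. h $ (1, 1));
          dx = (\<lambda>h::point. - h $ (1, 0)); dy = (\<lambda>h::point. h $ (0, 0));
          \<theta>xx = pd (1, 0) (pd (1, 0) \<theta>) p;
          \<theta>yy = pd (0, 0) (pd (0, 0) \<theta>) p;
          \<theta>xy = - pd (0, 0) (pd (1, 0) \<theta>) p
      in dw u * dx v + dx u * dw v + dz u * dy v + dy u * dz v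
         - 2 * \<theta>xx * dz u * dz v - 2 * \<theta>yy * dw u * dw v
         + 2 * \<theta>xy * (dw u * dz v + dz u * dw v))"

text \<open>The tetrad \<open>e\<^sub>A\<^sub>0\<^sub>' = \<partial>\<^sub>A\<^sub>0\<close>, \<open>e\<^sub>A\<^sub>1\<^sub>' = \<partial>\<^sub>A\<^sub>1 + {\<partial>\<^sub>A\<^sub>0 \<theta>, \<cdot>}\<^sub>y\<^sub>x\<close>. The 2-plane with primed spinor
  \<open>\<pi>\<^sub>A\<^sub>'\<close> is spanned by the \<open>\<pi>\<^sub>1\<^sub>' e\<^sub>A\<^sub>0\<^sub>' - \<pi>\<^sub>0\<^sub>' e\<^sub>A\<^sub>1\<^sub>'\<close>, which annihilate the twistor functions;
  this fixes which of the two spin bundles is the primed one.\<close>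

definition heavenly_tetrad :: "(point \<Rightarrow> complex) \<Rightarrow> tetrad" where
  "heavenly_tetrad \<theta> A A' p =
     (if A' = 0 then axis (A, 0) 1
      else axis (A, 1) 1
           + dY 0 (pd (A, 0) \<theta>) p *s (- axis (1, 0) 1)
           - dX 0 (pd (A, 0) \<theta>) p *s axis (0, 0) 1)"

lemma heavenly_tetrad_null:
  assumes "pd (1, 0) (pd (0, 0) \<theta>) p = pd (0, 0) (pd (1, 0) \<theta>) p"
  shows "null_tetrad_at (heavenly_metric \<theta>) (heavenly_tetrad \<theta>) p"
proof -
  have two: "A = 0 \<or> A = 1" for A :: 2
    using exhaust_2[of A] by auto
  show ?thesis
    unfolding null_tetrad_at_def
  proof (intro allI)
    fix A A' B B' :: 2
    show "heavenly_metric \<theta> p (heavenly_tetrad \<theta> A A' p) (heavenly_tetrad \<theta> B B' p) =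
          eps A B * eps A' B'"
      using two[of A] two[of A'] two[of B] two[of B'] assms
      by (elim disjE)
        (simp_all add: heavenly_metric_def heavenly_tetrad_def eps_def dX_def dY_def
          axis_def Let_def algebra_simps)
  qed
qed

end

theory Submission
  imports Defs "HOL-Complex_Analysis.Cauchy_Integral_Formula"
begin

text \<open>
  Write \<open>e\<^sub>A\<^sub>0 = \<partial>\<^sub>A\<^sub>0\<close> and \<open>e\<^sub>A\<^sub>1 = \<partial>\<^sub>A\<^sub>1 + {\<partial>\<^sub>A\<^sub>0 \<Theta>, \<cdot>}\<^sub>y\<^sub>x\<close>. The hierarchy says that
  \<open>\<pi>\<^sub>1\<^sub>' e\<^sub>A\<^sub>0 - \<pi>\<^sub>0\<^sub>' e\<^sub>A\<^sub>1\<close> annihilates the twistor functions, hence it lies in the kernel of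
  \<open>\<Sigma>(\<pi>)\<close>. The one-form \<open>\<alpha> = K \<lrcorner> \<Sigma>(\<pi>)\<close>, of degree \<open>2 n\<close> in \<open>\<pi>\<close>, therefore restricts to the slice as
  \<open>\<pi>\<^sub>A\<^sub>' e\<^sup>A\<^sup>A\<^sup>' \<kappa>\<^sub>A(\<pi>)\<close> with \<open>\<kappa>\<close> of degree \<open>2 n - 1\<close>; this \<open>\<kappa>\<close> is the spinor field. As
  \<open>\<Sigma>\<close> is closed, the symmetry condition reads \<open>d\<alpha> = - \<phi> \<cdot> \<partial>\<^sub>\<pi> \<Sigma>\<close>. On the slice the right-hand side
  is a combination of the \<open>\<Sigma>\<^sup>A\<^sup>'\<^sup>B\<^sup>'\<close>, so the part of \<open>d\<alpha>\<close> symmetric in unprimed indices, which is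
  \<open>\<pi>\<^sup>A\<^sup>' \<nabla>\<^sub>A\<^sub>'\<^sub>(\<^sub>A \<kappa>\<^sub>B\<^sub>)\<close>, vanishes.

  If \<open>\<kappa>\<close> vanished identically, then \<open>K = 0\<close> on the slice, because \<open>\<Sigma>\<close> is non-degenerate against
  the \<open>\<partial>\<^sub>A\<^sub>0\<close>. Differentiating the symmetry condition repeatedly then shows that \<open>\<phi>\<close> and \<open>K\<close> vanish to
  infinite order along the slice, and \<open>K = 0\<close> everywhere by the identity theorem.
\<close>

section \<open>Partial derivatives of holomorphic functions\<close>

lemma norm_smult_vec [simp]: "norm (c *s v) = norm c * norm v" for c :: complex and v :: "complex ^ 'k::finite"
  by (simp add: norm_vec_def L2_set_def vector_scalar_mult_def norm_mult power_mult_distrib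
      flip: sum_distrib_left) (simp add: real_sqrt_mult)

lemma bounded_linear_smult_left: "bounded_linear (\<lambda>t. t *s (v :: complex ^ 'k::finite))"
proof (rule bounded_linear_intro[where K = "norm v"])
qed (auto simp: vec_eq_iff vector_sadd_rdistrib scaleR_conv_of_real[where 'a = complex] mult.assoc mult.commute[of "norm v"] ring_distribs)

lemma has_derivative_line:
  fixes x v :: "complex ^ 'k::finite"
  assumes "(f has_derivative f') (at (x + t *s v))"
  shows "((\<lambda>t. f (x + t *s v)) has_derivative (\<lambda>s. f' (s *s v))) (at t)"
proof -
  have "((\<lambda>t. x + t *s v) has_derivative (\<lambda>s. s *s v)) (at t)"
    using bounded_linear.has_derivative[OF bounded_linear_smult_left has_derivative_ident]
    by (auto intro!: derivative_eq_intros)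
  from diff_chain_at[OF this assms] show ?thesis by (simp add: o_def)
qed

lemma vec_basis_expansion: "h = (\<Sum>k\<in>UNIV. (h $ k) *s axis k 1)" for h :: "complex ^ 'k::finite"
  by (simp add: vec_eq_iff axis_def if_distrib[of "\<lambda>x. _ * x"] cong: if_cong)

text \<open>\<open>has_derivative\<close> is only real-linear; homogeneity of \<open>f'\<close>
  under complex factors makes the derivative along a complex line a one-variable complex derivative,
  so the one-variable theory applies on every line.\<close>

lemma holo_on_line_field_derivative:
  assumes "holo_on f U" "x + t *s v \<in> U"
  obtains f' where "(f has_derivative f') (at (x + t *s v))" "\<And>c v. f' (c *s v) = c * f' v"
    "((\<lambda>t. f (x + t *s v)) has_field_derivative f' v) (at t)"
proof -
  from assms obtain f' where f': "(f has_derivative f') (at (x + t *s v))" "\<And>c v. f' (c *s v) = c * f' v"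
    unfolding holo_on_def by blast
  from has_derivative_line[OF f'(1)] have "((\<lambda>t. f (x + t *s v)) has_field_derivative f' v) (at t)"
    unfolding has_field_derivative_def by (rule has_derivative_eq_rhs) (auto simp: f'(2) mult.commute)
  with f' that show ?thesis by blast
qed

lemma pd_line: 
  assumes "holo_on f U" "x + t *s axis k 1 \<in> U"
  shows "((\<lambda>t. f (x + t *s axis k 1)) has_field_derivative pd k f (x + t *s axis k 1)) (at t)"
proof -
  obtain f' where f': "(f has_derivative f') (at (x + t *s axis k 1))"
    "((\<lambda>t. f (x + t *s axis k 1)) has_field_derivative f' (axis k 1)) (at t)"
    by (rule holo_on_line_field_derivative[OF assms])
  have U0: "x + t *s axis k 1 + 0 *s axis k 1 \<in> U" using assms by simp
  obtain f'' where f'': "(f has_derivative f'') (at (x + t *s axis k 1 + 0 *s axis k 1))"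
    "((\<lambda>s. f (x + t *s axis k 1 + s *s axis k 1)) has_field_derivative f'' (axis k 1)) (at 0)"
    by (rule holo_on_line_field_derivative[OF assms(1) U0])
  have "f'' = f'" using f'(1) f''(1) by (simp add: has_derivative_unique)
  moreover have "pd k f (x + t *s axis k 1) = f'' (axis k 1)"
    unfolding pd_def using f''(2) by (rule DERIV_imp_deriv)
  ultimately show ?thesis using f' by simp
qed

text \<open>A complex-linear derivative is determined by its values on the coordinate axes, and
  these are the numbers \<open>pd k f x\<close>.\<close>

lemma holo_on_has_derivative:
  assumes "holo_on f U" "x \<in> U"
  shows "(f has_derivative (\<lambda>h. \<Sum>k\<in>UNIV. pd k f x * h $ k)) (at x)"
proof -
  obtain f' where f': "(f has_derivative f') (at x)" "\<And>c v. f' (c *s v) = c * f' v"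
    using assms unfolding holo_on_def by blast
  interpret f': bounded_linear f' using f'(1) by (rule has_derivative_bounded_linear)
  have pd: "pd k f x = f' (axis k 1)" for k
  proof -
    have U0: "x + 0 *s axis k 1 \<in> U" using assms by simp
    obtain f'' where f'': "(f has_derivative f'') (at (x + 0 *s axis k 1))"
      "((\<lambda>s. f (x + s *s axis k 1)) has_field_derivative f'' (axis k 1)) (at 0)"
      by (rule holo_on_line_field_derivative[OF assms(1) U0])
    have "f'' = f'" using f'(1) f''(1) by (simp add: has_derivative_unique)
    then show ?thesis unfolding pd_def using f''(2) by (auto intro: DERIV_imp_deriv)
  qed
  have "f' h = (\<Sum>k\<in>UNIV. pd k f x * h $ k)" for h
    by (subst vec_basis_expansion[of h]) (simp add: f'.sum f'(2) pd mult.commute)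
  then have "f' = (\<lambda>h. \<Sum>k\<in>UNIV. pd k f x * h $ k)" by (rule ext)
  then show ?thesis using f'(1) by simp
qed

lemma holo_onI:
  assumes "\<And>x. x \<in> U \<Longrightarrow> (f has_derivative (\<lambda>h. \<Sum>k\<in>UNIV. D k x * h $ k)) (at x)"
  shows "holo_on f U"
  unfolding holo_on_def
proof safe
  fix x assume "x \<in> U"
  from assms[OF this] show "\<exists>f'. (f has_derivative f') (at x) \<and> (\<forall>c v. f' (c *s v) = c * f' v)"
    by (intro exI[of _ "\<lambda>h. \<Sum>k\<in>UNIV. D k x * h $ k"]) (auto simp: sum_distrib_left mult_ac)
qed

lemma pd_eqI:
  assumes "(f has_derivative (\<lambda>h. \<Sum>k\<in>UNIV. D k * h $ k)) (at x)"
  shows "pd k f x = D k"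
proof -
  \<comment> \<open>\<open>holo_on\<close> refers to the full filter \<open>at x\<close>, so even a
    one-point set is a meaningful domain.\<close>
  have "holo_on f {x}" using assms by (intro holo_onI[where D = "\<lambda>k _. D k"]) auto
  from holo_on_has_derivative[OF this, of x] 
  have "(\<lambda>h. \<Sum>k\<in>UNIV. pd k f x * h $ k) = (\<lambda>h. \<Sum>k\<in>UNIV. D k * h $ k)"
    using assms by (intro has_derivative_unique) auto
  from fun_cong[OF this, of "axis k 1"] show ?thesis
    by (simp add: axis_def if_distrib[of "\<lambda>x. _ * x"] cong: if_cong)
qed

lemma holo_on_continuous_on: "holo_on f U \<Longrightarrow> continuous_on U f"
  by (auto intro!: continuous_at_imp_continuous_on has_derivative_continuous[OF holo_on_has_derivative])

section \<open>Cauchy's formula and smoothness\<close>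

text \<open>The weight in Cauchy's formula for the first derivative, with the circle parametrised
  over the unit interval. Contour integrals become integrals over a fixed interval, which can be
  differentiated in a parameter.\<close>

definition cauchy_kernel :: "real \<Rightarrow> real \<Rightarrow> complex" where
  "cauchy_kernel r s = vector_derivative (circlepath 0 r) (at s) / (circlepath 0 r s)\<^sup>2 / (2 * of_real pi * \<i>)"

lemma continuous_on_cauchy_kernel: 
  assumes "r > 0" shows "continuous_on {0..1} (cauchy_kernel r)"
proof -
  have "continuous_on {0..1} (\<lambda>s. 2 * of_real pi * \<i> * r * exp (2 * of_real pi * \<i> * of_real s)
      / (circlepath 0 r s)\<^sup>2 / (2 * of_real pi * \<i>))" (is "continuous_on _ ?g")
    using assms unfolding circlepath by (intro continuous_intros) auto
  also have "?this \<longleftrightarrow> ?thesis"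
    by (intro continuous_on_cong) (auto simp: cauchy_kernel_def vector_derivative_circlepath)
  finally show ?thesis .
qed

lemma pd_cauchy:
  assumes f: "\<And>u. u \<in> cball 0 r \<Longrightarrow> (\<lambda>t. f (x + t *s axis k 1)) field_differentiable at u" and "r > 0"
  shows "pd k f x = integral {0..1} (\<lambda>s. cauchy_kernel r s * f (x + circlepath 0 r s *s axis k 1))"
proof -
  let ?g = "\<lambda>t. f (x + t *s axis k 1)"
  have c: "continuous_on (cball 0 r) ?g"
    using f by (meson continuous_at_imp_continuous_on field_differentiable_imp_continuous_at)
  have h: "?g holomorphic_on ball 0 r"
    by (auto intro!: holomorphic_onI field_differentiable_at_within f)
  have "(?g has_field_derivative (1 / (2 * of_real pi * \<i>) * contour_integral(circlepath 0 r) (\<lambda>u. ?g u / (u-0)^2))) (at 0)"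
    by (rule Cauchy_derivative_integral_circlepath(2)[OF c h]) (use \<open>r > 0\<close> in auto)
  then have "pd k f x = 1 / (2 * of_real pi * \<i>) * contour_integral(circlepath 0 r) (\<lambda>u. ?g u / (u-0)^2)"
    unfolding pd_def by (rule DERIV_imp_deriv)
  also have "\<dots> = integral {0..1} (\<lambda>s. 1 / (2 * of_real pi * \<i>) * (?g (circlepath 0 r s) / (circlepath 0 r s - 0)^2
         * vector_derivative (circlepath 0 r) (at s)))"
    by (simp only: contour_integral_integral integral_mult_right)
  also have "\<dots> = integral {0..1} (\<lambda>s. cauchy_kernel r s * f (x + circlepath 0 r s *s axis k 1))"
    by (intro integral_cong) (simp add: cauchy_kernel_def field_simps)
  finally show ?thesis .
qed

lemma norm_circlepath0: "r > 0 \<Longrightarrow> norm (circlepath 0 r s) = r"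
  by (simp add: circlepath norm_mult)

lemma continuous_on_circle_shift:
  fixes f :: "complex ^ 'k::finite \<Rightarrow> complex"
  assumes "continuous_on U f" "\<And>x. x \<in> V \<Longrightarrow> cball x r \<subseteq> U" "r > 0"
  shows "continuous_on (V \<times> {0..1}) (\<lambda>(x, s). cauchy_kernel r s * f (x + circlepath 0 r s *s axis k 1))"
proof -
  have 1: "continuous_on (V \<times> {0..1}) (\<lambda>p. cauchy_kernel r (snd p))"
    by (rule continuous_on_compose2[OF continuous_on_cauchy_kernel[OF \<open>r > 0\<close>]]) (auto intro!: continuous_intros)
  have 2: "continuous_on (V \<times> {0..1}) (\<lambda>p. f (fst p + circlepath 0 r (snd p) *s axis k 1))"
  proof (rule continuous_on_compose2[OF assms(1)])
    have "continuous_on (V \<times> {0..1}) (\<lambda>p. circlepath 0 r (snd p) *s (axis k 1 :: complex ^ 'k))"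
      by (rule bounded_linear.continuous_on[OF bounded_linear_smult_left])
        (auto simp: circlepath intro!: continuous_intros)
    then show "continuous_on (V \<times> {0..1}) (\<lambda>p. fst p + circlepath 0 r (snd p) *s (axis k 1 :: complex ^ 'k))"
      by (intro continuous_intros)
    show "(\<lambda>p. fst p + circlepath 0 r (snd p) *s axis k 1) ` (V \<times> {0..1}) \<subseteq> U"
    proof safe
      fix x s assume "x \<in> V"
      have "x + circlepath 0 r s *s axis k 1 \<in> cball x r"
        using norm_circlepath0[OF \<open>r > 0\<close>] by (simp add: dist_norm norm_axis_1)
      with assms(2)[OF \<open>x \<in> V\<close>] show "fst (x, s) + circlepath 0 r (snd (x, s)) *s axis k 1 \<in> U" by auto
    qed
  qed
  from continuous_on_mult[OF 1 2] show ?thesis by (simp add: split_beta)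
qed

lemma holo_on_pd_cauchy:
  assumes "holo_on f U" "cball x r \<subseteq> U" "r > 0"
  shows "pd k f x = integral {0..1} (\<lambda>s. cauchy_kernel r s * f (x + circlepath 0 r s *s axis k 1))"
proof (rule pd_cauchy[OF _ \<open>r > 0\<close>])
  fix u :: complex assume "u \<in> cball 0 r"
  then have "x + u *s axis k 1 \<in> U" using assms(2) by (auto simp: dist_norm norm_axis_1)
  from pd_line[OF assms(1) this]
  show "(\<lambda>t. f (x + t *s axis k 1)) field_differentiable at u"
    unfolding field_differentiable_def by blast
qed

text \<open>A third of the radius leaves room for circles of one common radius about all nearby
  points, so one integral formula serves a whole ball.\<close>

lemma ball_room:
  fixes U :: "'a::real_normed_vector set"
  assumes "open U" "x \<in> U"
  obtains r where "r > 0" "\<And>y. y \<in> ball x r \<Longrightarrow> cball y r \<subseteq> U"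
proof -
  obtain e where e: "e > 0" "ball x e \<subseteq> U" using assms openE by blast
  have "cball y (e/3) \<subseteq> U" if "y \<in> ball x (e/3)" for y
  proof
    fix z assume "z \<in> cball y (e/3)"
    then have "dist x z \<le> dist x y + dist y z" "dist x y < e/3" "dist y z \<le> e/3"
      using that by (auto intro: dist_triangle)
    then show "z \<in> U" using e by (intro subsetD[OF e(2)]) auto
  qed
  with e that[of "e/3"] show ?thesis by auto
qed

text \<open>Locally \<open>pd k f\<close> is a Cauchy integral containing only \<open>f\<close>
  itself, and the integral inherits continuity in the base point.\<close>

lemma continuous_on_pd:
  assumes "open U" "holo_on f U"
  shows "continuous_on U (pd k f)"
proof (rule continuous_at_imp_continuous_on, rule ballI)
  fix x assume "x \<in> U"
  obtain r where r: "r > 0" "\<And>y. y \<in> ball x r \<Longrightarrow> cball y r \<subseteq> U"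
    using ball_room[OF assms(1) \<open>x \<in> U\<close>] by metis
  have "continuous_on (ball x r) (\<lambda>x. integral (cbox 0 1) (\<lambda>s. cauchy_kernel r s * f (x + circlepath 0 r s *s axis k 1)))"
    by (rule integral_continuous_on_param)
      (use continuous_on_circle_shift[OF holo_on_continuous_on[OF assms(2)], of "ball x r" r k] r in simp)
  then have "continuous_on (ball x r) (pd k f)"
    by (rule continuous_on_eq) (use holo_on_pd_cauchy[OF assms(2) r(2) r(1)] in auto)
  then show "isCont (pd k f) x"
    using r(1) by (simp add: continuous_on_eq_continuous_at)
qed

lemma continuous_on_Pair_section:
  assumes "continuous_on (A \<times> B) (\<lambda>(x, s). f x s)" "x \<in> A"
  shows "continuous_on B (f x)"
proof -
  have "continuous_on B (\<lambda>s. (x, s))" by (intro continuous_on_Pair continuous_on_id continuous_on_const)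
  from continuous_on_compose2[OF assms(1) this] assms(2) show ?thesis by auto
qed

text \<open>Differentiation under the integral sign in Cauchy's formula, which is legitimate because the
  same formula shows that the first derivatives are continuous. The explicit integrals also give
  the symmetry of second derivatives.\<close>

lemma pd_has_derivative:
  fixes f :: "complex ^ 'k::finite \<Rightarrow> complex"
  assumes "open U" "holo_on f U" and x: "x \<in> U"
  obtains r where "r > 0" "cball x r \<subseteq> U" 
   "(pd k f has_derivative (\<lambda>h. \<Sum>j\<in>UNIV. integral {0..1} (\<lambda>s. cauchy_kernel r s * pd j f (x + circlepath 0 r s *s axis k 1)) * h $ j)) (at x)"
proof -
  obtain r where r: "r > 0" "\<And>y. y \<in> ball x r \<Longrightarrow> cball y r \<subseteq> U"
    using ball_room[OF assms(1) \<open>x \<in> U\<close>] by metis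
  let ?G = "\<lambda>j y s. cauchy_kernel r s * pd j f (y + circlepath 0 r s *s axis k 1)"
  \<comment> \<open>\<open>leibniz_rule\<close> wants the derivative of the integrand as a bounded
    linear map, jointly continuous in both variables; it is assembled here from its
    components.\<close>
  define fx where "fx y s = Blinfun (\<lambda>h. \<Sum>j\<in>UNIV. ?G j y s * h $ j)" for y s
  have bl: "bounded_linear (\<lambda>h::complex^'k. \<Sum>j\<in>UNIV. ?G j y s * h $ j)" for y s
    by (intro bounded_linear_sum bounded_linear_const_mult bounded_linear_vec_nth)
  have fx: "blinfun_apply (fx y s) h = (\<Sum>j\<in>UNIV. ?G j y s * h $ j)" for y s h
    unfolding fx_def by (simp add: bounded_linear_Blinfun_apply[OF bl])
  have inU: "y + circlepath 0 r s *s axis k 1 \<in> U" if "y \<in> ball x r" for y s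
  proof -
    have "y + circlepath 0 r s *s axis k 1 \<in> cball y r"
      using norm_circlepath0[OF \<open>r > 0\<close>] by (simp add: dist_norm norm_axis_1)
    with r(2)[OF that] show ?thesis by auto
  qed
  have contF: "continuous_on (ball x r \<times> {0..1}) (\<lambda>(y,s). cauchy_kernel r s * f (y + circlepath 0 r s *s axis k 1))"
    by (rule continuous_on_circle_shift[OF holo_on_continuous_on[OF assms(2)] r(2) r(1)])
  have contG: "continuous_on (ball x r \<times> {0..1}) (\<lambda>(y,s). ?G j y s)" for j
    by (rule continuous_on_circle_shift[OF continuous_on_pd[OF assms(1,2)] r(2) r(1)])
  have "((\<lambda>y. integral (cbox 0 1) (\<lambda>s. cauchy_kernel r s * f (y + circlepath 0 r s *s axis k 1)))
     has_derivative integral (cbox 0 1) (fx x)) (at x within ball x r)"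
  proof (rule leibniz_rule)
    fix y s assume y: "y \<in> ball x r"
    have "((\<lambda>y. f (y + circlepath 0 r s *s axis k 1)) has_derivative 
       (\<lambda>h. \<Sum>j\<in>UNIV. pd j f (y + circlepath 0 r s *s axis k 1) * h $ j)) (at y)"
    proof -
      have "((\<lambda>y. y + circlepath 0 r s *s axis k 1) has_derivative (\<lambda>h. h)) (at y)"
        by (auto intro!: derivative_eq_intros)
      from diff_chain_at[OF this holo_on_has_derivative[OF assms(2) inU[OF y]]]
      show ?thesis by (simp add: o_def)
    qed
    then have "((\<lambda>y. cauchy_kernel r s * f (y + circlepath 0 r s *s axis k 1)) has_derivative
       (\<lambda>h. cauchy_kernel r s * (\<Sum>j\<in>UNIV. pd j f (y + circlepath 0 r s *s axis k 1) * h $ j))) (at y within ball x r)"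
      by (rule has_derivative_mult_right[OF has_derivative_at_withinI])
    moreover have "(\<lambda>h. cauchy_kernel r s * (\<Sum>j\<in>UNIV. pd j f (y + circlepath 0 r s *s axis k 1) * h $ j))
       = blinfun_apply (fx y s)"
      by (rule ext) (simp add: fx sum_distrib_left mult.assoc)
    ultimately show "((\<lambda>y. cauchy_kernel r s * f (y + circlepath 0 r s *s axis k 1)) has_derivative blinfun_apply (fx y s)) (at y within ball x r)"
      by (simp only:)
  next
    fix y assume "y \<in> ball x r"
    then show "(\<lambda>s. cauchy_kernel r s * f (y + circlepath 0 r s *s axis k 1)) integrable_on cbox 0 1"
      by (intro integrable_continuous) (use continuous_on_Pair_section[OF contF] in simp)
  next
    show "continuous_on (ball x r \<times> cbox 0 1) (\<lambda>(x, t). fx x t)"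
    proof (rule continuous_on_blinfun_componentwise)
      fix i :: "complex ^ 'k"
      have "continuous_on (ball x r \<times> cbox 0 1) (\<lambda>p. ?G j (fst p) (snd p) * i $ j)" for j
        using contG[of j] by (intro continuous_on_mult[OF _ continuous_on_const]) (simp add: split_beta)
      then have "continuous_on (ball x r \<times> cbox 0 1) (\<lambda>p. \<Sum>j\<in>UNIV. ?G j (fst p) (snd p) * i $ j)"
        by (rule continuous_on_sum)
      then show "continuous_on (ball x r \<times> cbox 0 1) (\<lambda>p. blinfun_apply (case p of (y, s) \<Rightarrow> fx y s) i)"
        by (simp add: split_beta fx)
    qed
  qed (use r(1) in simp_all)
  then have "((\<lambda>y. integral (cbox 0 1) (\<lambda>s. cauchy_kernel r s * f (y + circlepath 0 r s *s axis k 1)))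
     has_derivative integral (cbox 0 1) (fx x)) (at x)"
    using r(1) by (simp add: at_within_open[of x "ball x r"])
  note D = this
  have I: "blinfun_apply (integral (cbox 0 1) (fx x)) h = 
     (\<Sum>j\<in>UNIV. integral {0..1} (?G j x) * h $ j)" for h
  proof -
    have cG: "continuous_on {0..1} (?G j x)" for j
      by (rule continuous_on_Pair_section[OF contG]) (use r(1) in simp)
    have cfx: "continuous_on (cbox 0 1) (fx x)"
    proof (rule continuous_on_blinfun_componentwise)
      fix i :: "complex ^ 'k"
      have "continuous_on (cbox 0 1) (\<lambda>s. ?G j x s * i $ j)" for j
        using cG[of j] by (intro continuous_on_mult[OF _ continuous_on_const]) simp
      then have "continuous_on (cbox 0 1) (\<lambda>s. \<Sum>j\<in>UNIV. ?G j x s * i $ j)"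
        by (rule continuous_on_sum)
      then show "continuous_on (cbox 0 1) (\<lambda>s. blinfun_apply (fx x s) i)"
        by (simp add: fx)
    qed
    have "blinfun_apply (integral (cbox 0 1) (fx x)) h = integral (cbox 0 1) (\<lambda>s. fx x s h)"
      using integral_linear[OF integrable_continuous[OF cfx] blinfun.bounded_linear_left[of h]] by (simp add: o_def)
    also have "\<dots> = (\<Sum>j\<in>UNIV. integral {0..1} (\<lambda>s. ?G j x s * h $ j))"
      unfolding fx by (subst integral_sum) 
         (auto intro!: integrable_continuous_interval continuous_on_mult[OF cG continuous_on_const])
    finally show ?thesis by simp
  qed
  have "((\<lambda>y. integral (cbox 0 1) (\<lambda>s. cauchy_kernel r s * f (y + circlepath 0 r s *s axis k 1)))
     has_derivative (\<lambda>h. (\<Sum>j\<in>UNIV. integral {0..1} (?G j x) * h $ j))) (at x)"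
    by (rule has_derivative_eq_rhs[OF D]) (rule ext, rule I)
  then have "(pd k f has_derivative (\<lambda>h. (\<Sum>j\<in>UNIV. integral {0..1} (?G j x) * h $ j))) (at x)"
  proof (rule has_derivative_transform_within[OF _ r(1)])
    fix y assume "dist y x < r"
    then have "y \<in> ball x r" by (simp add: dist_commute)
    from holo_on_pd_cauchy[OF assms(2) r(2)[OF this] r(1), of k]
    show "integral (cbox 0 1) (\<lambda>s. cauchy_kernel r s * f (y + circlepath 0 r s *s axis k 1)) = pd k f y"
      by simp
  qed simp
  note E = this
  have "cball x r \<subseteq> U" using r by simp
  show ?thesis
    by (rule that) fact+
qed

lemma holo_on_pd:
  fixes f :: "complex ^ 'k::finite \<Rightarrow> complex"
  assumes "open U" "holo_on f U"
  shows "holo_on (pd k f) U"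
  unfolding holo_on_def
proof
  fix x assume "x \<in> U"
  have "\<exists>D. (pd k f has_derivative (\<lambda>h. \<Sum>j\<in>UNIV. D j * h $ j)) (at x)"
    by (rule pd_has_derivative[OF assms \<open>x \<in> U\<close>]) (rule exI)
  then obtain D where "(pd k f has_derivative (\<lambda>h. \<Sum>j\<in>UNIV. D j * h $ j)) (at x)" ..
  then show "\<exists>f'. (pd k f has_derivative f') (at x) \<and> (\<forall>c v. f' (c *s v) = c * f' v)"
    by (intro exI[of _ "\<lambda>h. \<Sum>j\<in>UNIV. D j * h $ j"]) (auto simp: sum_distrib_left mult_ac)
qed

text \<open>Differentiating the integral for \<open>pd k f\<close> in direction \<open>j\<close>
  puts \<open>pd j f\<close> under the integral sign; read backwards, this is Cauchy's formula for
  \<open>pd k (pd j f)\<close>.\<close>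

lemma pd_commute:
  fixes f :: "complex ^ 'k::finite \<Rightarrow> complex"
  assumes "open U" "holo_on f U" "x \<in> U"
  shows "pd j (pd k f) x = pd k (pd j f) x"
proof -
  obtain r where r: "r > 0" "cball x r \<subseteq> U" 
   "(pd k f has_derivative (\<lambda>h. \<Sum>j\<in>UNIV. integral {0..1} (\<lambda>s. cauchy_kernel r s * pd j f (x + circlepath 0 r s *s axis k 1)) * h $ j)) (at x)"
    by (rule pd_has_derivative[OF assms])
  have "pd j (pd k f) x = integral {0..1} (\<lambda>s. cauchy_kernel r s * pd j f (x + circlepath 0 r s *s axis k 1))"
    by (rule pd_eqI[OF r(3)])
  also have "\<dots> = pd k (pd j f) x"
    by (rule holo_on_pd_cauchy[symmetric, OF holo_on_pd[OF assms(1,2)] r(2) r(1)])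
  finally show ?thesis .
qed

lemma pd_cong:
  assumes "open U" "x \<in> U" "\<And>y. y \<in> U \<Longrightarrow> f y = g y"
  shows "pd k f x = pd k g x"
proof -
  have "isCont (\<lambda>t. x + t *s axis k (1::complex)) 0"
    by (intro continuous_intros bounded_linear.isCont[OF bounded_linear_smult_left])
  then have "\<forall>\<^sub>F t in nhds 0. x + t *s axis k 1 \<in> U"
    using assms(1,2) by (auto simp: isCont_def tendsto_def eventually_nhds_conv_at)
  then have "\<forall>\<^sub>F t in nhds 0. f (x + t *s axis k 1) = g (x + t *s axis k 1)"
    by eventually_elim (rule assms(3))
  then show ?thesis unfolding pd_def by (rule deriv_cong_ev) simp
qed

section \<open>Calculus rules for partial derivatives\<close>

named_theorems holo_intros

lemma holo_on_const [holo_intros]: "holo_on (\<lambda>x. c) U"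
  by (rule holo_onI[where D = "\<lambda>_ _. 0"]) simp

lemma pd_const [simp]: "pd k (\<lambda>x. c) x = 0"
  by (simp add: pd_def)

lemma coord_has_derivative:
  "((\<lambda>x. x $ j) has_derivative (\<lambda>h. \<Sum>k\<in>UNIV. (if k = j then 1 else 0) * h $ k)) (at x)"
  for x :: "complex ^ 'k::finite"
  by (simp add: if_distrib[of "\<lambda>x. x * _"] bounded_linear.has_derivative[OF bounded_linear_vec_nth] cong: if_cong)

lemma holo_on_coord [holo_intros]: "holo_on (\<lambda>x. x $ j) U"
  by (rule holo_onI) (rule coord_has_derivative)

lemma pd_coord: "pd k (\<lambda>x. x $ j) x = (if k = j then 1 else 0)"
  by (rule pd_eqI) (rule coord_has_derivative)

context
  fixes f g :: "complex ^ 'k::finite \<Rightarrow> complex" and U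
  assumes f: "holo_on f U" and g: "holo_on g U"
begin

lemma add_has_derivative:
  "x \<in> U \<Longrightarrow> ((\<lambda>x. f x + g x) has_derivative (\<lambda>h. \<Sum>k\<in>UNIV. (pd k f x + pd k g x) * h $ k)) (at x)"
  by (rule has_derivative_eq_rhs[OF has_derivative_add[OF holo_on_has_derivative[OF f] holo_on_has_derivative[OF g]]])
    (auto simp: sum.distrib algebra_simps)

lemma holo_on_add [holo_intros]: "holo_on (\<lambda>x. f x + g x) U"
  by (rule holo_onI) (rule add_has_derivative)

lemma pd_add: "x \<in> U \<Longrightarrow> pd k (\<lambda>x. f x + g x) x = pd k f x + pd k g x"
  by (rule pd_eqI) (rule add_has_derivative)

lemma mult_has_derivative:
  "x \<in> U \<Longrightarrow> ((\<lambda>x. f x * g x) has_derivative (\<lambda>h. \<Sum>k\<in>UNIV. (pd k f x * g x + f x * pd k g x) * h $ k)) (at x)"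
  by (rule has_derivative_eq_rhs[OF has_derivative_mult[OF holo_on_has_derivative[OF f] holo_on_has_derivative[OF g]]])
    (auto simp: sum.distrib sum_distrib_left algebra_simps)

lemma holo_on_mult [holo_intros]: "holo_on (\<lambda>x. f x * g x) U"
  by (rule holo_onI) (rule mult_has_derivative)

lemma pd_mult: "x \<in> U \<Longrightarrow> pd k (\<lambda>x. f x * g x) x = pd k f x * g x + f x * pd k g x"
  by (rule pd_eqI) (rule mult_has_derivative)

end

lemma pd_cmult: "holo_on f U \<Longrightarrow> x \<in> U \<Longrightarrow> pd k (\<lambda>x. c * f x) x = c * pd k f x"
  using pd_mult[OF holo_on_const] by fastforce

lemma holo_on_minus [holo_intros]: "holo_on f U \<Longrightarrow> holo_on (\<lambda>x. - f x) U"
  using holo_on_mult[OF holo_on_const[of "-1"]] by fastforce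

lemma pd_minus: "holo_on f U \<Longrightarrow> x \<in> U \<Longrightarrow> pd k (\<lambda>x. - f x) x = - pd k f x"
  using pd_cmult[of f U x k "-1"] by simp

lemma holo_on_diff [holo_intros]: "holo_on f U \<Longrightarrow> holo_on g U \<Longrightarrow> holo_on (\<lambda>x. f x - g x) U"
  using holo_on_add[OF _ holo_on_minus] by fastforce

lemma pd_diff: "holo_on f U \<Longrightarrow> holo_on g U \<Longrightarrow> x \<in> U \<Longrightarrow> pd k (\<lambda>x. f x - g x) x = pd k f x - pd k g x"
  using pd_add[OF _ holo_on_minus, of f U g x k] by (simp add: pd_minus)

lemma holo_on_sum [holo_intros]: "(\<And>i. i \<in> A \<Longrightarrow> holo_on (f i) U) \<Longrightarrow> holo_on (\<lambda>x. \<Sum>i\<in>A. f i x) U"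
  by (induction A rule: infinite_finite_induct) (auto intro!: holo_intros)

lemma pd_sum: 
  "(\<And>i. i \<in> A \<Longrightarrow> holo_on (f i) U) \<Longrightarrow> x \<in> U \<Longrightarrow> pd k (\<lambda>x. \<Sum>i\<in>A. f i x) x = (\<Sum>i\<in>A. pd k (f i) x)"
proof (induction A rule: infinite_finite_induct)
  case (insert a A)
  then have "holo_on (f a) U" "holo_on (\<lambda>x. \<Sum>i\<in>A. f i x) U"
    by (auto intro: holo_on_sum)
  with insert show ?case by (simp add: pd_add[where U = U])
qed auto

lemmas pd_simps = pd_add pd_diff pd_minus pd_mult pd_cmult pd_sum

section \<open>Iterated derivatives, order of vanishing, identity theorem\<close>

primrec pds :: "'k list \<Rightarrow> (complex ^ 'k::finite \<Rightarrow> complex) \<Rightarrow> complex ^ 'k \<Rightarrow> complex" where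
  "pds [] f = f"
| "pds (k # I) f = pds I (pd k f)"

lemma pds_cong:
  assumes "open U" "x \<in> U" "\<And>y. y \<in> U \<Longrightarrow> f y = g y"
  shows "pds I f x = pds I g x"
  using assms(3)
proof (induction I arbitrary: f g)
  case (Cons k I)
  have "pd k f y = pd k g y" if "y \<in> U" for y
    by (rule pd_cong[OF assms(1) that Cons.prems])
  from Cons.IH[OF this] show ?case by simp
qed (use assms(2) in simp)

lemma holo_on_pds: "open U \<Longrightarrow> holo_on f U \<Longrightarrow> holo_on (pds I f) U"
  by (induction I arbitrary: f) (auto intro: holo_on_pd)

lemma pds_lincomb:
  assumes "open U" "x \<in> U" "\<And>i. i \<in> A \<Longrightarrow> holo_on (f i) U"
  shows "pds I (\<lambda>y. \<Sum>i\<in>A. c i * f i y) x = (\<Sum>i\<in>A. c i * pds I (f i) x)"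
  using assms(3)
proof (induction I arbitrary: f)
  case (Cons k I)
  have "pd k (\<lambda>y. \<Sum>i\<in>A. c i * f i y) y = (\<Sum>i\<in>A. c i * pd k (f i) y)" if "y \<in> U" for y
    using Cons.prems that by (simp add: pd_sum[where U = U] pd_cmult[where U = U] holo_intros)
  then have "pds (k # I) (\<lambda>y. \<Sum>i\<in>A. c i * f i y) x = pds I (\<lambda>y. \<Sum>i\<in>A. c i * pd k (f i) y) x"
    unfolding pds.simps by (rule pds_cong[OF assms(1,2)])
  with Cons show ?case using assms(1) by (simp add: holo_on_pd)
qed simp

lemma pds_add:
  assumes "open U" "x \<in> U" "holo_on f U" "holo_on g U"
  shows "pds I (\<lambda>y. f y + g y) x = pds I f x + pds I g x"
  using pds_lincomb[OF assms(1,2), of "UNIV :: bool set" "\<lambda>b. if b then f else g" I "\<lambda>_. 1"] assms(3,4)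
  by (simp add: UNIV_bool add.commute)

lemma pds_sum:
  assumes "open U" "x \<in> U" "\<And>i. i \<in> A \<Longrightarrow> holo_on (f i) U"
  shows "pds I (\<lambda>y. \<Sum>i\<in>A. f i y) x = (\<Sum>i\<in>A. pds I (f i) x)"
  using pds_lincomb[OF assms(1,2), of A f I "\<lambda>_. 1"] assms(3) by simp

lemma pds_zero: "pds I (\<lambda>y. 0) x = 0"
  by (induction I) (simp_all add: pd_const[abs_def])

text \<open>The head of the list acts first; this moves it to the outside, where it can be read as a
  derivative along the slice of a function that vanishes there.\<close>

lemma pds_pd:
  assumes "open U" "x \<in> U" "holo_on f U"
  shows "pds I (pd k f) x = pd k (pds I f) x"
  using assms(3)
proof (induction I arbitrary: f)
  case (Cons j I)
  have "pds I (pd j (pd k f)) x = pds I (pd k (pd j f)) x"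
    by (rule pds_cong[OF assms(1,2)]) (rule pd_commute[OF assms(1) Cons.prems])
  also have "\<dots> = pd k (pds I (pd j f)) x"
    by (rule Cons.IH[OF holo_on_pd[OF assms(1) Cons.prems]])
  finally show ?case by simp
qed simp

text \<open>Order of vanishing at least \<open>r\<close> along \<open>S\<close>. The derivatives run
  over all ambient directions, including those transversal to \<open>S\<close>.\<close>

definition vanishes_to :: "nat \<Rightarrow> (complex ^ 'k) set \<Rightarrow> (complex ^ 'k::finite \<Rightarrow> complex) \<Rightarrow> bool" where
  "vanishes_to r S f \<longleftrightarrow> (\<forall>I. length I < r \<longrightarrow> (\<forall>p\<in>S. pds I f p = 0))"

lemma vanishes_to_0 [simp]: "vanishes_to 0 S f"
  by (simp add: vanishes_to_def)

lemma vanishes_to_pd: "vanishes_to (Suc r) S f \<Longrightarrow> vanishes_to r S (pd k f)"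
  unfolding vanishes_to_def by (metis Suc_less_eq length_Cons pds.simps(2))

lemma vanishes_to_le: "vanishes_to r S f \<Longrightarrow> s \<le> r \<Longrightarrow> vanishes_to s S f"
  unfolding vanishes_to_def by auto

lemma vanishes_to_SucI:
  "vanishes_to r S f \<Longrightarrow> (\<And>I p. length I = r \<Longrightarrow> p \<in> S \<Longrightarrow> pds I f p = 0) \<Longrightarrow> vanishes_to (Suc r) S f"
  unfolding vanishes_to_def by (metis less_Suc_eq)

text \<open>In the Leibniz expansion, a term with a derivative on \<open>g\<close> has fewer than
  \<open>r\<close> derivatives left for \<open>f\<close>, hence is zero on \<open>S\<close>.\<close>

lemma pds_mult_vanishes:
  assumes "open U" "holo_on f U" "holo_on g U" "S \<subseteq> U" "p \<in> S" "vanishes_to r S f" "length I \<le> r"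
  shows "pds I (\<lambda>x. f x * g x) p = pds I f p * g p"
  using assms(2,3,6,7)
proof (induction I arbitrary: f g r)
  case (Cons k I)
  have p: "p \<in> U" using assms by auto
  note h = Cons.prems(1,2) holo_on_pd[OF assms(1) Cons.prems(1)] holo_on_pd[OF assms(1) Cons.prems(2)]
  obtain s where r: "r = Suc s" using Cons.prems(4) by (cases r) auto
  have "pds (k # I) (\<lambda>x. f x * g x) p = pds I (\<lambda>x. pd k f x * g x + f x * pd k g x) p"
    unfolding pds.simps by (rule pds_cong[OF assms(1) p]) (rule pd_mult[OF Cons.prems(1,2)])
  also have "\<dots> = pds I (\<lambda>x. pd k f x * g x) p + pds I (\<lambda>x. f x * pd k g x) p"
    by (rule pds_add[OF assms(1) p]; intro holo_intros h)
  also have "pds I (\<lambda>x. pd k f x * g x) p = pds I (pd k f) p * g p"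
    using Cons.prems r by (intro Cons.IH[OF h(3,2), of s] vanishes_to_pd) auto
  also have "pds I (\<lambda>x. f x * pd k g x) p = pds I f p * pd k g p"
    using Cons.prems r by (intro Cons.IH[OF h(1,4) vanishes_to_le[OF Cons.prems(3), of s]]) auto
  also have "pds I f p = 0"
    using Cons.prems assms(5) by (simp add: vanishes_to_def)
  finally show ?case by simp
qed simp

lemma line_has_field_derivative:
  assumes "holo_on f U" "x + t *s v \<in> U"
  shows "((\<lambda>t. f (x + t *s v)) has_field_derivative (\<Sum>k\<in>UNIV. v $ k * pd k f (x + t *s v))) (at t)"
  using has_derivative_line[OF holo_on_has_derivative[OF assms]] unfolding has_field_derivative_def
  by (rule has_derivative_eq_rhs) (simp add: fun_eq_iff sum_distrib_left mult_ac)

text \<open>Along the line, \<open>deriv\<close> is the constant-coefficient combination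
  \<open>?D\<close> of partial derivatives; all its iterated derivatives vanish at \<open>x\<close>
  too, so the induction can continue with \<open>?D\<close>.\<close>

lemma higher_deriv_line_zero:
  assumes "open U" "x \<in> U" "holo_on f U" "\<And>I. pds I f x = 0"
  shows "(deriv ^^ n) (\<lambda>t. f (x + t *s v)) 0 = 0"
  using assms(3,4)
proof (induction n arbitrary: f)
  case 0
  from "0.prems"(2)[of "[]"] show ?case by simp
next
  case (Suc n)
  let ?D = "\<lambda>y. \<Sum>k\<in>UNIV. v $ k * pd k f y"
  note h = holo_on_pd[OF assms(1) Suc.prems(1)]
  have hD: "holo_on ?D U" by (intro holo_intros h)
  have "pds I ?D x = 0" for I
  proof -
    have "pds I ?D x = (\<Sum>k\<in>UNIV. v $ k * pds I (pd k f) x)"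
      by (rule pds_lincomb[OF assms(1,2)]) (rule h)
    with Suc.prems(2)[of "_ # I"] show ?thesis by simp
  qed
  from Suc.IH[OF hD this] have 0: "(deriv ^^ n) (\<lambda>t. ?D (x + t *s v)) 0 = 0" by simp
  have "isCont (\<lambda>t. x + t *s v) 0"
    by (intro continuous_intros bounded_linear.isCont[OF bounded_linear_smult_left])
  then have "\<forall>\<^sub>F t in nhds 0. x + t *s v \<in> U"
    using assms(1,2) by (auto simp: isCont_def tendsto_def eventually_nhds_conv_at)
  then have "\<forall>\<^sub>F t in nhds 0. deriv (\<lambda>t. f (x + t *s v)) t = ?D (x + t *s v)"
    by eventually_elim (intro DERIV_imp_deriv line_has_field_derivative[OF Suc.prems(1)])
  then have "(deriv ^^ n) (deriv (\<lambda>t. f (x + t *s v))) 0 = (deriv ^^ n) (\<lambda>t. ?D (x + t *s v)) 0"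
    by (rule higher_deriv_cong_ev) simp
  with 0 show ?case by (simp add: funpow_Suc_right del: funpow.simps)
qed

text \<open>On the complex line through \<open>x\<close> and \<open>y\<close> the function has zero
  Taylor series at the centre of a disc of radius \<open>R > 1\<close>, which contains the parameter
  1 of \<open>y\<close>.\<close>

lemma zero_near_infinite_order_zero:
  assumes "open U" "x \<in> U" "holo_on f U" "\<And>I. pds I f x = 0" "ball x r \<subseteq> U" "y \<in> ball x r"
  shows "f y = 0"
proof (cases "y = x")
  case True
  with assms(4)[of "[]"] show ?thesis by simp
next
  case False
  define v where "v = y - x"
  define R where "R = r / norm v"
  have v: "norm v > 0" using False by (simp add: v_def)
  have "norm v < r" using assms(6) by (simp add: v_def dist_norm norm_minus_commute)
  then have R: "R > 1" using v by (simp add: R_def)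
  have "x + t *s v \<in> U" if "t \<in> ball 0 R" for t
  proof -
    have "norm t * norm v < r" using that v by (simp add: R_def field_simps)
    then have "x + t *s v \<in> ball x r" by (simp add: dist_norm)
    with assms(5) show ?thesis by blast
  qed
  then have "(\<lambda>t. f (x + t *s v)) holomorphic_on ball 0 R"
    using line_has_field_derivative[OF assms(3)] by (subst holomorphic_on_open) blast+
  then have "f (x + 1 *s v) = 0"
    by (rule holomorphic_fun_eq_0_on_ball) (use R higher_deriv_line_zero[OF assms(1-4)] in auto)
  then show ?thesis by (simp add: v_def)
qed

text \<open>The points of infinite-order vanishing form an open set by the previous lemma and a
  relatively closed one as an intersection of zero sets.\<close>

lemma holo_on_identity_theorem:
  assumes "open U" "connected U" "x \<in> U" "holo_on f U" "\<And>I. pds I f x = 0" "y \<in> U"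
  shows "f y = 0"
proof -
  define S where "S = {p\<in>U. \<forall>I. pds I f p = 0}"
  have "open S"
  proof (rule openI)
    fix p assume p: "p \<in> S"
    then obtain r where r: "r > 0" "ball p r \<subseteq> U" using assms(1) openE unfolding S_def by blast
    have "q \<in> S" if "q \<in> ball p r" for q
    proof -
      have "f z = 0" if "z \<in> ball p r" for z
        using zero_near_infinite_order_zero[OF assms(1) _ assms(4) _ r(2) that] p by (auto simp: S_def)
      then have "pds I f q = pds I (\<lambda>_. 0) q" for I
        using that by (intro pds_cong[of "ball p r"]) auto
      with r that show ?thesis by (auto simp: S_def pds_zero)
    qed
    with r(1) show "\<exists>r>0. ball p r \<subseteq> S" by blast
  qed
  then have "openin (top_of_set U) S"
    by (intro openin_open_subtopology[THEN iffD2]) (auto simp: S_def assms(1) openin_open_eq)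
  moreover have "S = (\<Inter>I. {p\<in>U. pds I f p = 0})" by (auto simp: S_def)
  then have "closedin (top_of_set U) S"
    using holo_on_continuous_on[OF holo_on_pds[OF assms(1,4)]]
    by (auto intro!: closedin_INT continuous_closedin_preimage_constant)
  ultimately have "S = {} \<or> S = U" using assms(2) by (simp add: connected_clopen)
  moreover have "x \<in> S" using assms by (simp add: S_def)
  ultimately have "y \<in> S" using assms(6) by blast
  then have "pds [] f y = 0" unfolding S_def by blast
  then show ?thesis by simp
qed

section \<open>The two-forms of the hierarchy\<close>

lemma two_cases: "A = 0 \<or> A = 1" for A :: 2
  using exhaust_2[of A] by auto

lemma UNIV_two: "(UNIV :: 2 set) = {0, 1}"
  using two_cases by auto

lemma sum_two: "(\<Sum>A\<in>UNIV. f A) = f 0 + f 1" for f :: "2 \<Rightarrow> 'a::comm_monoid_add"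
  by (simp add: UNIV_two)

text \<open>The coefficient of \<open>\<partial>\<^sub>C\<^sub>0\<close> in the Hamiltonian vector
  field \<open>{\<partial>\<^sub>A\<^sub>0 \<Theta>, \<cdot>}\<^sub>y\<^sub>x\<close>; the signs
  come from \<open>\<partial>\<^sub>x = - \<partial>\<^sub>1\<^sub>0\<close>.\<close>

definition twistor_hamil :: "'m \<Rightarrow> (complex ^ (2 \<times> 'm::finite) \<Rightarrow> complex) \<Rightarrow> 2 \<Rightarrow> 2 \<Rightarrow> complex ^ (2 \<times> 'm) \<Rightarrow> complex" where
  "twistor_hamil l \<Theta> A C p = (if C = 0 then pd (1, l) (pd (A, l) \<Theta>) p else - pd (0, l) (pd (A, l) \<Theta>) p)"

text \<open>The value of a one-form \<open>\<alpha>\<close> on \<open>e\<^sub>A\<^sub>1\<close>.\<close>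

definition contract_frame ::
  "(nat \<Rightarrow> 'm) \<Rightarrow> (complex ^ (2 \<times> 'm::finite) \<Rightarrow> complex) \<Rightarrow> 2 \<Rightarrow> complex ^ (2 \<times> 'm) \<Rightarrow> (2 \<times> 'm \<Rightarrow> complex) \<Rightarrow> complex" where
  "contract_frame \<iota> \<Theta> A p \<alpha> = \<alpha> (A, \<iota> 1) + (\<Sum>C\<in>UNIV. twistor_hamil (\<iota> 0) \<Theta> A C p * \<alpha> (C, \<iota> 0))"

lemma contract_frame_add: "contract_frame \<iota> \<Theta> A p (\<lambda>a. \<alpha> a + \<beta> a) = contract_frame \<iota> \<Theta> A p \<alpha> + contract_frame \<iota> \<Theta> A p \<beta>"
  by (simp add: contract_frame_def sum_two algebra_simps)

lemma contract_frame_cmult: "contract_frame \<iota> \<Theta> A p (\<lambda>a. c * \<alpha> a) = c * contract_frame \<iota> \<Theta> A p \<alpha>"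
  by (simp add: contract_frame_def sum_two algebra_simps)

lemma contract_frame_multc: "contract_frame \<iota> \<Theta> A p (\<lambda>a. \<alpha> a * c) = contract_frame \<iota> \<Theta> A p \<alpha> * c"
  by (simp add: contract_frame_def sum_two algebra_simps)

lemma contract_frame_minus: "contract_frame \<iota> \<Theta> A p (\<lambda>a. - \<alpha> a) = - contract_frame \<iota> \<Theta> A p \<alpha>"
  using contract_frame_cmult[of \<iota> \<Theta> A p "-1" \<alpha>] by simp

lemma contract_frame_diff: "contract_frame \<iota> \<Theta> A p (\<lambda>a. \<alpha> a - \<beta> a) = contract_frame \<iota> \<Theta> A p \<alpha> - contract_frame \<iota> \<Theta> A p \<beta>"
  by (simp add: contract_frame_def sum_two algebra_simps)

lemma contract_frame_zero [simp]: "contract_frame \<iota> \<Theta> A p (\<lambda>a. 0) = 0"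
  by (simp add: contract_frame_def)

lemma contract_frame_sum: "contract_frame \<iota> \<Theta> A p (\<lambda>a. \<Sum>i\<in>I. \<alpha> i a) = (\<Sum>i\<in>I. contract_frame \<iota> \<Theta> A p (\<alpha> i))"
  by (induction I rule: infinite_finite_induct) (simp_all add: contract_frame_add)

lemma contract_frame_swap:
  "contract_frame \<iota> \<Theta> A p (\<lambda>a. contract_frame \<iota> \<Theta> B p (\<lambda>b. \<sigma> a b)) =
   contract_frame \<iota> \<Theta> B p (\<lambda>b. contract_frame \<iota> \<Theta> A p (\<lambda>a. \<sigma> a b))"
  by (simp add: contract_frame_def sum_two algebra_simps)

text \<open>For two power series in \<lambda> whose coefficients are one-forms, this is the
  coefficient of \<open>\<lambda>\<^sup>k\<close> in their wedge product.\<close>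

definition wedge :: "(nat \<Rightarrow> 'k \<Rightarrow> complex) \<Rightarrow> (nat \<Rightarrow> 'k \<Rightarrow> complex) \<Rightarrow> nat \<Rightarrow> 'k \<Rightarrow> 'k \<Rightarrow> complex" where
  "wedge u w k a b = (\<Sum>j\<le>k. u j a * w (k - j) b - u j b * w (k - j) a)"

lemma wedge_antisym: "wedge u w k a b = - wedge u w k b a"
  by (simp add: wedge_def flip: sum_negf)

text \<open>Let \<open>F\<close> be evaluation on a vector. The hypotheses say that the vector of
  index \<open>x\<close> minus \<lambda> times that vector annihilates both series; it then
  annihilates their wedge product. The claim compares coefficients of
  \<open>\<lambda>\<^sup>k\<^sup>+\<^sup>1\<close>.\<close>

lemma wedge_shift:
  assumes "\<And>j. j \<le> k \<Longrightarrow> u (Suc j) x = F (u j)" "\<And>j. j \<le> k \<Longrightarrow> w (Suc j) x = F (w j)"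
    and "u 0 x = 0" "w 0 x = 0"
    and F: "\<And>I \<alpha>. F (\<lambda>a. \<Sum>i\<in>(I::nat set). \<alpha> i a) = (\<Sum>i\<in>I. F (\<alpha> i))" "\<And>c \<alpha>. F (\<lambda>a. \<alpha> a * c) = F \<alpha> * c"
      "\<And>c \<alpha>. F (\<lambda>a. c * \<alpha> a) = c * F \<alpha>" "\<And>\<alpha> \<beta>. F (\<lambda>a. \<alpha> a - \<beta> a) = F \<alpha> - F \<beta>"
  shows "wedge u w (Suc k) x b = F (\<lambda>a. wedge u w k a b)"
proof -
  have "wedge u w (Suc k) x b = (\<Sum>j\<le>Suc k. u j x * w (Suc k - j) b) - (\<Sum>j\<le>Suc k. u j b * w (Suc k - j) x)"
    by (simp add: wedge_def sum_subtractf)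
  also have "(\<Sum>j\<le>Suc k. u j x * w (Suc k - j) b) = (\<Sum>j\<le>k. F (u j) * w (k - j) b)"
    by (subst sum.atMost_Suc_shift) (simp add: assms)
  also have "(\<Sum>j\<le>Suc k. u j b * w (Suc k - j) x) = (\<Sum>j\<le>k. u j b * F (w (k - j)))"
    by (simp add: assms Suc_diff_le)
  also have "(\<Sum>j\<le>k. F (u j) * w (k - j) b) - \<dots> = F (\<lambda>a. wedge u w k a b)"
    by (simp add: wedge_def F sum_subtractf)
  finally show ?thesis .
qed

lemma wedge_0: "u 0 x = 0 \<Longrightarrow> w 0 x = 0 \<Longrightarrow> wedge u w 0 x b = 0"
  by (simp add: wedge_def)

lemma Sigma_coeff_wedge:
  "Sigma_coeff n \<iota> \<Theta> k p = wedge (\<lambda>j a. pd a (tw_coeff n \<iota> \<Theta> 0 j) p) (\<lambda>j a. pd a (tw_coeff n \<iota> \<Theta> 1 j) p) k"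
  by (rule ext)+ (simp only: Sigma_coeff_def wedge_def)

text \<open>Cartan's formula: for a closed form only the exterior derivative of the interior product
  survives.\<close>

lemma lie_2form_closed:
  assumes "open U" "p \<in> U" and K: "\<And>c. holo_on (\<lambda>q. K q $ c) U" and \<sigma>: "\<And>a b. holo_on (\<lambda>q. \<sigma> q a b) U"
    and anti: "\<And>q a b. q \<in> U \<Longrightarrow> \<sigma> q a b = - \<sigma> q b a"
    and closed: "\<And>a b c. pd c (\<lambda>q. \<sigma> q a b) p + pd a (\<lambda>q. \<sigma> q b c) p + pd b (\<lambda>q. \<sigma> q c a) p = 0"
  shows "lie_2form K \<sigma> p a b =
     pd a (\<lambda>q. \<Sum>c\<in>UNIV. K q $ c * \<sigma> q c b) p - pd b (\<lambda>q. \<Sum>c\<in>UNIV. K q $ c * \<sigma> q c a) p"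
proof -
  have \<sigma>': "pd d (\<lambda>q. \<sigma> q b c) p = - pd d (\<lambda>q. \<sigma> q c b) p" for b c d
  proof -
    have "pd d (\<lambda>q. \<sigma> q b c) p = pd d (\<lambda>q. - \<sigma> q c b) p"
      by (rule pd_cong[OF assms(1,2)]) (rule anti)
    also have "\<dots> = - pd d (\<lambda>q. \<sigma> q c b) p" by (rule pd_minus[OF \<sigma> assms(2)])
    finally show ?thesis .
  qed
  have "pd a (\<lambda>q. \<Sum>c\<in>UNIV. K q $ c * \<sigma> q c b) p =
      (\<Sum>c\<in>UNIV. pd a (\<lambda>q. K q $ c) p * \<sigma> p c b + K p $ c * pd a (\<lambda>q. \<sigma> q c b) p)" for a b
    using assms(2) by (simp add: pd_sum[where U = U] pd_mult[where U = U] holo_intros K \<sigma>)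
  then have "pd a (\<lambda>q. \<Sum>c\<in>UNIV. K q $ c * \<sigma> q c b) p - pd b (\<lambda>q. \<Sum>c\<in>UNIV. K q $ c * \<sigma> q c a) p
      = (\<Sum>c\<in>UNIV. pd a (\<lambda>q. K q $ c) p * \<sigma> p c b - pd b (\<lambda>q. K q $ c) p * \<sigma> p c a
         + K p $ c * (pd a (\<lambda>q. \<sigma> q c b) p - pd b (\<lambda>q. \<sigma> q c a) p))"
    by (simp add: algebra_simps flip: sum_subtractf)
  also have "\<dots> = lie_2form K \<sigma> p a b"
    unfolding lie_2form_def
  proof (rule sum.cong[OF refl])
    fix c
    have "pd a (\<lambda>q. \<sigma> q c b) p - pd b (\<lambda>q. \<sigma> q c a) p = pd c (\<lambda>q. \<sigma> q a b) p"
      using closed[of c a b] \<sigma>'[of a b c] by (simp add: algebra_simps)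
    moreover have "\<sigma> p a c = - \<sigma> p c a" using anti assms(2) by blast
    ultimately show "pd a (\<lambda>q. K q $ c) p * \<sigma> p c b - pd b (\<lambda>q. K q $ c) p * \<sigma> p c a
         + K p $ c * (pd a (\<lambda>q. \<sigma> q c b) p - pd b (\<lambda>q. \<sigma> q c a) p) = 
        K p $ c * pd c (\<lambda>q. \<sigma> q a b) p + \<sigma> p c b * pd a (\<lambda>q. K q $ c) p + \<sigma> p a c * pd b (\<lambda>q. K q $ c) p"
      by (simp add: algebra_simps)
  qed
  finally show ?thesis ..
qed

lemma lie_2form_lincomb:
  assumes "p \<in> U" "\<And>k a b. k \<in> A \<Longrightarrow> holo_on (\<lambda>q. \<sigma> k q a b) U"
  shows "lie_2form K (\<lambda>q a b. \<Sum>k\<in>A. m k * \<sigma> k q a b) p a b = (\<Sum>k\<in>A. m k * lie_2form K (\<sigma> k) p a b)"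
proof -
  have "pd c (\<lambda>q. \<Sum>k\<in>A. m k * \<sigma> k q a b) p = (\<Sum>k\<in>A. m k * pd c (\<lambda>q. \<sigma> k q a b) p)" for c a b
    using assms by (simp add: pd_sum[where U = U] pd_cmult[where U = U] holo_intros)
  then have "lie_2form K (\<lambda>q a b. \<Sum>k\<in>A. m k * \<sigma> k q a b) p a b =
     (\<Sum>c\<in>UNIV. \<Sum>k\<in>A. m k * (K p $ c * pd c (\<lambda>q. \<sigma> k q a b) p
        + \<sigma> k p c b * pd a (\<lambda>q. K q $ c) p + \<sigma> k p a c * pd b (\<lambda>q. K q $ c) p))"
    by (simp add: lie_2form_def sum_distrib_left sum_distrib_right sum.distrib algebra_simps)
  also have "\<dots> = (\<Sum>k\<in>A. m k * lie_2form K (\<sigma> k) p a b)"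
    unfolding lie_2form_def by (subst sum.swap) (simp add: sum_distrib_left)
  finally show ?thesis .
qed

definition fibre_monomial :: "nat \<Rightarrow> nat \<Rightarrow> complex ^ 2 \<Rightarrow> complex" where
  "fibre_monomial n k \<pi> = (\<pi> $ 0) ^ k * (\<pi> $ 1) ^ (2 * n - k)"

lemma holo_on_power [holo_intros]: "holo_on f U \<Longrightarrow> holo_on (\<lambda>x. f x ^ m) U"
  by (induction m) (auto intro: holo_intros)

lemma holo_on_fibre_monomial: "holo_on (fibre_monomial n k) U"
  unfolding fibre_monomial_def[abs_def] by (intro holo_intros)

lemma Sigma_form_monomials:
  "Sigma_form n \<iota> \<Theta> \<pi> p a b = (\<Sum>k\<le>2*n. fibre_monomial n k \<pi> * Sigma_coeff n \<iota> \<Theta> k p a b)"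
  by (simp add: Sigma_form_def fibre_monomial_def)

lemma pd_Sigma_form:
  "pd B' (\<lambda>\<rho>. Sigma_form n \<iota> \<Theta> \<rho> p a b) \<pi> = (\<Sum>k\<le>2*n. pd B' (fibre_monomial n k) \<pi> * Sigma_coeff n \<iota> \<Theta> k p a b)"
proof -
  have "pd B' (\<lambda>\<rho>. Sigma_coeff n \<iota> \<Theta> k p a b * fibre_monomial n k \<rho>) \<pi> = Sigma_coeff n \<iota> \<Theta> k p a b * pd B' (fibre_monomial n k) \<pi>" for k
    by (rule pd_cmult[OF holo_on_fibre_monomial UNIV_I])
  then show ?thesis
    unfolding Sigma_form_monomials
    by (subst pd_sum[where U = UNIV]) (auto intro!: holo_intros holo_on_fibre_monomial simp: mult.commute)
qed

text \<open>Setting \<open>\<pi>\<^sub>1\<^sub>' = 1\<close> turns the sum into a polynomial in one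
  variable that vanishes identically.\<close>

lemma fibre_monomials_independent:
  assumes "\<And>\<pi>. (\<Sum>k\<le>2*n. fibre_monomial n k \<pi> * c k) = 0" "k \<le> 2 * n"
  shows "c k = 0"
proof -
  have "(\<Sum>k\<le>2*n. c k * z ^ k) = 0" for z
    using assms(1)[of "\<chi> i. if i = 0 then z else 1"] by (simp add: fibre_monomial_def mult.commute)
  then show ?thesis using assms(2) polyfun_eq_0[of c "2*n"] by blast
qed

section \<open>The kernel and non-degeneracy of \<Sigma>\<close>

locale hierarchy =
  fixes n :: nat and \<iota> :: "nat \<Rightarrow> 'm::finite"
    and U :: "(complex ^ (2 \<times> 'm)) set" and \<Theta> :: "complex ^ (2 \<times> 'm) \<Rightarrow> complex"
  assumes n: "n \<ge> 1" and bij: "bij_betw \<iota> {0..n} UNIV" and U: "open U"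
    and sol: "hierarchy_solution n \<iota> U \<Theta>"
begin

abbreviation "tw \<equiv> tw_coeff n \<iota> \<Theta>"
abbreviation "\<sigma> \<equiv> Sigma_coeff n \<iota> \<Theta>"
abbreviation "H \<equiv> twistor_hamil (\<iota> 0) \<Theta>"
abbreviation "E \<equiv> contract_frame \<iota> \<Theta>"

lemma holo_Theta: "holo_on \<Theta> U"
  using sol by (simp add: hierarchy_solution_def)

lemma iota_eq: "i \<le> n \<Longrightarrow> j \<le> n \<Longrightarrow> \<iota> i = \<iota> j \<longleftrightarrow> i = j"
  using bij by (auto simp: bij_betw_def inj_on_def)

lemma holo_tw: "holo_on (tw A k) U"
  unfolding tw_coeff_def[abs_def]
  by (cases "k \<le> n"; cases "A = 0") (auto intro!: holo_intros holo_on_pd U holo_Theta)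

lemma holo_H: "holo_on (H A C) U"
  unfolding twistor_hamil_def[abs_def]
  by (cases "C = 0") (auto intro!: holo_intros holo_on_pd U holo_Theta)

lemma holo_Sigma: "holo_on (\<lambda>q. \<sigma> k q a b) U"
  unfolding Sigma_coeff_def by (intro holo_intros holo_on_pd U holo_tw)

lemma tw_low: "k \<le> n \<Longrightarrow> tw A k = (\<lambda>p. p $ (A, \<iota> (n - k)))"
  by (simp add: tw_coeff_def[abs_def])

lemma tw_high: "k > n \<Longrightarrow> tw A k = (\<lambda>p. if A = 0 then pd (1, \<iota> (k - (n + 1))) \<Theta> p else - pd (0, \<iota> (k - (n + 1))) \<Theta> p)"
  by (simp add: tw_coeff_def[abs_def])

lemma pd_tw_low: "k \<le> n \<Longrightarrow> pd a (tw A k) p = (if a = (A, \<iota> (n - k)) then 1 else 0)"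
  by (simp add: tw_low pd_coord)

lemma pd_tw_high: "k > n \<Longrightarrow> p \<in> U \<Longrightarrow> pd a (tw A k) p = 
  (if A = 0 then pd a (pd (1, \<iota> (k - (n + 1))) \<Theta>) p else - pd a (pd (0, \<iota> (k - (n + 1))) \<Theta>) p)"
  using pd_minus[OF holo_on_pd[OF U holo_Theta]] by (auto simp: tw_high)

text \<open>The hierarchy equation with \<open>i = 1\<close>: its bracket term is the Hamiltonian
  part of \<open>e\<^sub>A\<^sub>1\<close>.\<close>

lemma hierarchy_contract:
  assumes "p \<in> U" "1 \<le> j" "j \<le> n"
  shows "pd (A, \<iota> 0) (pd (B, \<iota> j) \<Theta>) p = E A p (\<lambda>a. pd a (pd (B, \<iota> (j - 1)) \<Theta>) p)"
proof -
  have "pd (A, \<iota> 1) (pd (B, \<iota> (j - 1)) \<Theta>) p - pd (B, \<iota> j) (pd (A, \<iota> (1 - 1)) \<Theta>) p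
        + poisson_yx (\<iota> 0) (pd (A, \<iota> (1 - 1)) \<Theta>) (pd (B, \<iota> (j - 1)) \<Theta>) p = 0"
    using sol assms n unfolding hierarchy_solution_def by (meson atLeastAtMost_iff le_refl)
  moreover have "pd (A, \<iota> 0) (pd (B, \<iota> j) \<Theta>) p = pd (B, \<iota> j) (pd (A, \<iota> 0) \<Theta>) p"
    by (rule pd_commute[OF U holo_Theta assms(1)])
  ultimately show ?thesis
    by (simp add: contract_frame_def poisson_yx_def dX_def dY_def twistor_hamil_def sum_two algebra_simps)
qed

lemma tw_shift_0: "p \<in> U \<Longrightarrow> pd (A, \<iota> 0) (tw B 0) p = 0"
  using n by (simp add: pd_tw_low iota_eq)

text \<open>Order by order, \<open>e\<^sub>A\<^sub>0 - \<lambda> e\<^sub>A\<^sub>1\<close>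
  annihilates the twistor functions. Below order \<open>n\<close> only coordinates are compared; at
  \<open>k = n\<close> the bracket acts on \<open>x\<^sup>B\<^sup>0\<close> and second derivatives
  commute; beyond that it is \<open>hierarchy_contract\<close>.\<close>

lemma tw_shift:
  assumes p: "p \<in> U" and k: "k \<le> 2 * n"
  shows "pd (A, \<iota> 0) (tw B (Suc k)) p = E A p (\<lambda>a. pd a (tw B k) p)"
proof -
  consider "Suc k \<le> n" | "k = n" | "k > n" by linarith
  then show ?thesis
  proof cases
    case 1
    then have "n - Suc k = 0 \<longleftrightarrow> n - k = 1" by linarith
    with 1 n iota_eq[of 0 "n - Suc k"] iota_eq[of 0 "n - k"] iota_eq[of 1 "n - k"] show ?thesis
      by (auto simp: pd_tw_low contract_frame_def sum_two)
  next
    case 2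
    have "pd (A, \<iota> 0) (pd (C, \<iota> 0) \<Theta>) p = pd (C, \<iota> 0) (pd (A, \<iota> 0) \<Theta>) p" for C
      by (rule pd_commute[OF U holo_Theta p])
    with 2 n p iota_eq[of 0 1] two_cases[of B] show ?thesis
      by (auto simp: pd_tw_low pd_tw_high contract_frame_def sum_two twistor_hamil_def)
  next
    case 3
    have "k = n + 1 + (k - n - 1)" "Suc (k - n - 1) \<le> n" using 3 k by auto
    then obtain i where i: "k = n + 1 + i" "Suc i \<le> n" by blast
    then have "pd (A, \<iota> 0) (pd (C, \<iota> (Suc i)) \<Theta>) p = E A p (\<lambda>a. pd a (pd (C, \<iota> i) \<Theta>) p)" for C
      using hierarchy_contract[OF p, of "Suc i" A C] by simp
    with i p show ?thesis
      by (cases "B = 0") (simp_all add: pd_tw_high contract_frame_minus)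
  qed
qed

lemma Sigma_antisym: "\<sigma> k p a b = - \<sigma> k p b a"
  unfolding Sigma_coeff_wedge by (rule wedge_antisym)

text \<open>What annihilates both twistor functions lies in the kernel of \<Sigma>.\<close>

lemma Sigma_shift:
  assumes "p \<in> U" "k \<le> 2 * n"
  shows "\<sigma> (Suc k) p (A, \<iota> 0) b = E A p (\<lambda>a. \<sigma> k p a b)"
  unfolding Sigma_coeff_wedge
  by (rule wedge_shift)
    (use assms in \<open>auto simp: tw_shift tw_shift_0 contract_frame_sum contract_frame_cmult contract_frame_multc contract_frame_diff\<close>)

lemma Sigma_0: "p \<in> U \<Longrightarrow> \<sigma> 0 p (A, \<iota> 0) b = 0"
  unfolding Sigma_coeff_wedge by (rule wedge_0) (auto simp: tw_shift_0)

text \<open>This coefficient is \<open>- d(d\<Theta>)\<close>, because \<open>d\<Theta> = \<partial>\<^sub>A\<^sub>i \<Theta> dx\<^sup>A\<^sup>i\<close>.\<close>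

lemma Sigma_top:
  assumes p: "p \<in> U"
  shows "\<sigma> (2 * n + 1) p a b = 0"
proof -
  let ?F = "\<lambda>j. pd a (tw 0 j) p * pd b (tw 1 (2 * n + 1 - j)) p - pd b (tw 0 j) p * pd a (tw 1 (2 * n + 1 - j)) p"
  \<comment> \<open>The orders \<open>j\<close> and \<open>2 * n + 1 - j\<close> with
    \<open>j \<le> n\<close> pair a coordinate with its conjugate derivative of \<Theta>, both of
    label \<open>n - j\<close>; \<open>G\<close> is the joint contribution of such a pair.\<close>
  define G where "G i = (if a = (0, i) then - pd b (pd (0, i) \<Theta>) p else 0)
     + (if b = (0, i) then pd a (pd (0, i) \<Theta>) p else 0)
     + (if b = (1, i) then pd a (pd (1, i) \<Theta>) p else 0)
     - (if a = (1, i) then pd b (pd (1, i) \<Theta>) p else 0)" for i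
  have split: "{..2 * n + 1} = {..n} \<union> (\<lambda>j. 2 * n + 1 - j) ` {..n}"
  proof safe
    fix j assume "j \<le> 2 * n + 1" "j \<notin> (\<lambda>j. 2 * n + 1 - j) ` {..n}"
    moreover have "j = 2 * n + 1 - (2 * n + 1 - j)" using \<open>j \<le> 2 * n + 1\<close> by simp
    ultimately have "\<not> 2 * n + 1 - j \<le> n" by blast
    then show "j \<le> n" by linarith
  qed auto
  have "\<sigma> (2 * n + 1) p a b = sum ?F {..2 * n + 1}"
    by (simp add: Sigma_coeff_def)
  also have "\<dots> = sum ?F {..n} + sum ?F ((\<lambda>j. 2 * n + 1 - j) ` {..n})"
    unfolding split by (rule sum.union_disjoint) auto
  also have "sum ?F ((\<lambda>j. 2 * n + 1 - j) ` {..n}) = (\<Sum>j\<le>n. ?F (2 * n + 1 - j))"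
    by (subst sum.reindex) (auto simp: inj_on_def)
  also have "sum ?F {..n} + (\<Sum>j\<le>n. ?F (2 * n + 1 - j)) = (\<Sum>j\<le>n. ?F j + ?F (2 * n + 1 - j))"
    by (simp add: sum.distrib)
  also have "\<dots> = (\<Sum>j\<le>n. G (\<iota> (n - j)))"
  proof (rule sum.cong[OF refl])
    fix j assume "j \<in> {..n}"
    then have "2 * n + 1 - j > n" "2 * n + 1 - j - (n + 1) = n - j" "j \<le> n" "2 * n + 1 - (2 * n + 1 - j) = j" by auto
    then show "?F j + ?F (2 * n + 1 - j) = G (\<iota> (n - j))"
      using p by (simp add: pd_tw_low pd_tw_high G_def del: diff_diff_left)
  qed
  also have "\<dots> = (\<Sum>i\<in>{0..n}. G (\<iota> i))"
    unfolding atMost_atLeast0 by (rule sum.reindex_bij_witness[of _ "\<lambda>i. n - i" "\<lambda>i. n - i"]) auto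
  also have "\<dots> = (\<Sum>i\<in>UNIV. G i)"
    by (rule sum.reindex_bij_betw[OF bij])
  also have "\<dots> = 0"
  proof -
    obtain A i B j where ab: "a = (A, i)" "b = (B, j)" by fastforce
    have "pd a (pd b \<Theta>) p = pd b (pd a \<Theta>) p" by (rule pd_commute[OF U holo_Theta p])
    then show ?thesis
      using two_cases[of A] two_cases[of B]
      by (auto simp: G_def ab sum.distrib sum_subtractf)
  qed
  finally show ?thesis .
qed

text \<open>Every summand is a wedge product of two exact one-forms; the cyclic sum cancels because
  second derivatives commute.\<close>

lemma Sigma_closed:
  assumes p: "p \<in> U"
  shows "pd c (\<lambda>q. \<sigma> k q a b) p + pd a (\<lambda>q. \<sigma> k q b c) p + pd b (\<lambda>q. \<sigma> k q c a) p = 0"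
proof -
  note h = holo_tw holo_on_pd[OF U holo_tw]
  have eq: "pd c (\<lambda>q. \<sigma> k q a b) p = (\<Sum>j\<le>k. 
      pd c (pd a (tw 0 j)) p * pd b (tw 1 (k - j)) p + pd a (tw 0 j) p * pd c (pd b (tw 1 (k - j))) p
     - (pd c (pd b (tw 0 j)) p * pd a (tw 1 (k - j)) p + pd b (tw 0 j) p * pd c (pd a (tw 1 (k - j))) p))" for a b c
    unfolding Sigma_coeff_def 
    using p by (simp add: pd_sum[where U = U] pd_diff[where U = U] pd_mult[where U = U] h holo_intros)
  have comm: "pd a (pd b (tw A j)) p = pd b (pd a (tw A j)) p" for a b A j
    by (rule pd_commute[OF U holo_tw p])
  show ?thesis
    unfolding eq sum.distrib[symmetric]
    by (rule sum.neutral) (simp add: comm[of b a] comm[of c a] comm[of c b] algebra_simps)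
qed

end

lemma pd_power: "holo_on f U \<Longrightarrow> x \<in> U \<Longrightarrow> pd k (\<lambda>x. f x ^ m) x = of_nat m * f x ^ (m - 1) * pd k f x"
proof (induction m)
  case (Suc m)
  then have "pd k (\<lambda>x. f x * f x ^ m) x = pd k f x * f x ^ m + f x * pd k (\<lambda>x. f x ^ m) x"
    by (intro pd_mult[where U = U] holo_on_power)
  with Suc show ?case by (cases m) (simp_all add: algebra_simps)
qed simp

context hierarchy
begin

lemma tw_frame:
  assumes "j \<le> n" shows "pd (A, \<iota> 0) (tw B j) p = (if j = n \<and> A = B then 1 else 0)"
  using assms iota_eq[of 0 "n - j"] by (auto simp: pd_tw_low)

text \<open>The coordinate \<open>x\<^sup>A\<^sup>0\<close> first enters
  \<open>\<omega>\<^sup>A\<close> at order \<open>n\<close>, so up to order \<open>2 * n\<close>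
  only the product of the two terms of order \<open>n\<close> contributes.\<close>

lemma Sigma_frame_00:
  assumes "k \<le> 2 * n"
  shows "\<sigma> k p (0, \<iota> 0) (1, \<iota> 0) = (if k = 2 * n then 1 else 0)"
proof -
  have "\<sigma> k p (0, \<iota> 0) (1, \<iota> 0) = (\<Sum>j\<le>k. if j = n \<and> k = 2 * n then 1 else 0)"
    unfolding Sigma_coeff_def
  proof (rule sum.cong[OF refl])
    fix j assume "j \<in> {..k}"
    then consider "j < n" | "k - j < n" | "j = n" "k = 2 * n" using assms by fastforce
    then show "pd (0, \<iota> 0) (tw 0 j) p * pd (1, \<iota> 0) (tw 1 (k - j)) p -
       pd (1, \<iota> 0) (tw 0 j) p * pd (0, \<iota> 0) (tw 1 (k - j)) p = (if j = n \<and> k = 2 * n then 1 else 0)"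
      by cases (auto simp: tw_frame)
  qed
  also have "\<dots> = (if k = 2 * n then 1 else 0)" by simp
  finally show ?thesis .
qed

text \<open>Trading \<open>e\<^sub>1\<^sub>1\<close> for \<open>e\<^sub>1\<^sub>0\<close> raises the
  order by one; for \<open>k = 2 * n\<close> this lands on \<open>Sigma_top\<close>.\<close>

lemma Sigma_frame_01:
  assumes "k \<le> 2 * n" "p \<in> U"
  shows "E 1 p (\<lambda>b. \<sigma> k p (0, \<iota> 0) b) = (if k = 2 * n - 1 then 1 else 0)"
proof -
  have "E 1 p (\<lambda>b. \<sigma> k p (0, \<iota> 0) b) = - E 1 p (\<lambda>b. \<sigma> k p b (0, \<iota> 0))"
    by (subst Sigma_antisym) (simp add: contract_frame_minus)
  also have "\<dots> = - \<sigma> (Suc k) p (1, \<iota> 0) (0, \<iota> 0)"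
    using assms by (simp add: Sigma_shift)
  also have "\<dots> = \<sigma> (Suc k) p (0, \<iota> 0) (1, \<iota> 0)"
    by (subst Sigma_antisym) simp
  also have "\<dots> = (if k = 2 * n - 1 then 1 else 0)"
  proof (cases "k = 2 * n")
    case True
    with Sigma_top[OF assms(2)] n show ?thesis by simp
  next
    case False
    with assms n show ?thesis by (auto simp: Sigma_frame_00)
  qed
  finally show ?thesis .
qed

text \<open>The coordinate components of \<open>X\<close> are its values \<open>x B j\<close> on the
  coefficients of order at most \<open>n\<close>. The coefficient of order \<open>n + m\<close>,
  evaluated on \<open>\<partial>\<^sub>0\<^sub>0\<close> and
  \<open>\<partial>\<^sub>1\<^sub>0\<close>, gives \<open>x 1 m\<close> and \<open>x 0 m\<close> up
  to sign, once the lower ones are known to vanish.\<close>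

lemma Sigma_nondegenerate:
  assumes p: "p \<in> U" and zero: "\<And>k A. k \<le> 2 * n \<Longrightarrow> (\<Sum>c\<in>UNIV. X $ c * \<sigma> k p c (A, \<iota> 0)) = 0"
  shows "X = 0"
proof -
  define x where "x B j = (\<Sum>c\<in>UNIV. X $ c * pd c (tw B j) p)" for B j
  have expand: "(\<Sum>c\<in>UNIV. X $ c * \<sigma> k p c b) =
     (\<Sum>j\<le>k. x 0 j * pd b (tw 1 (k - j)) p - pd b (tw 0 j) p * x 1 (k - j))" for k b
  proof -
    have "(\<Sum>c\<in>UNIV. X $ c * \<sigma> k p c b) = (\<Sum>c\<in>UNIV. \<Sum>j\<le>k. X $ c * pd c (tw 0 j) p * pd b (tw 1 (k - j)) p
        - pd b (tw 0 j) p * (X $ c * pd c (tw 1 (k - j)) p))"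
      by (simp add: Sigma_coeff_def sum_distrib_left algebra_simps)
    also have "\<dots> = (\<Sum>j\<le>k. \<Sum>c\<in>UNIV. X $ c * pd c (tw 0 j) p * pd b (tw 1 (k - j)) p
        - pd b (tw 0 j) p * (X $ c * pd c (tw 1 (k - j)) p))"
      by (rule sum.swap)
    also have "\<dots> = (\<Sum>j\<le>k. x 0 j * pd b (tw 1 (k - j)) p - pd b (tw 0 j) p * x 1 (k - j))"
      by (simp add: x_def sum_subtractf sum_distrib_left sum_distrib_right)
    finally show ?thesis .
  qed
  have "m \<le> n \<Longrightarrow> x 0 m = 0 \<and> x 1 m = 0" for m
  proof (induction m rule: less_induct)
    case (less m)
    have IH: "x A j = 0" if "j < m" for A j
      using less.IH[of j] less.prems that two_cases[of A] by auto
    \<comment> \<open>The factor differentiated along \<open>\<partial>\<^sub>A\<^sub>0\<close> has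
      order at least \<open>n\<close>, so the other one has order at most \<open>m\<close>, and the
      induction hypothesis leaves only \<open>m\<close> itself.\<close>
    have "x 0 j * pd (A, \<iota> 0) (tw 1 (n + m - j)) p - pd (A, \<iota> 0) (tw 0 j) p * x 1 (n + m - j)
      = (if j = m then (if A = 1 then x 0 m else 0) else 0) - (if j = n then (if A = 0 then x 1 m else 0) else 0)"
      if "j \<le> n + m" for j A
    proof -
      have "x 0 j * pd (A, \<iota> 0) (tw 1 (n + m - j)) p = (if j = m then (if A = 1 then x 0 m else 0) else 0)"
      proof -
        consider "j < m" | "j = m" | "j > m" by linarith
        then show ?thesis using that by cases (auto simp: IH tw_frame)
      qed
      moreover have "pd (A, \<iota> 0) (tw 0 j) p * x 1 (n + m - j) = (if j = n then (if A = 0 then x 1 m else 0) else 0)"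
      proof -
        consider "j < n" | "j = n" | "j > n" by linarith
        then show ?thesis using that by cases (auto simp: IH tw_frame)
      qed
      ultimately show ?thesis by simp
    qed
    then have "(\<Sum>c\<in>UNIV. X $ c * \<sigma> (n + m) p c (A, \<iota> 0)) = 
      (\<Sum>j\<le>n + m. (if j = m then (if A = 1 then x 0 m else 0) else 0) - (if j = n then (if A = 0 then x 1 m else 0) else 0))" for A
      unfolding expand by (intro sum.cong refl) simp
    then have "(if A = 1 then x 0 m else 0) - (if A = 0 then x 1 m else 0) = 0" for A :: 2
      using zero[of "n + m" A] less.prems by (simp add: sum_subtractf)
    from this[of 0] this[of 1] show ?case by simp
  qed
  then have x: "x A m = 0" if "m \<le> n" for A m using that two_cases[of A] by auto
  have "X $ (A, l) = 0" for A l
  proof -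
    obtain i where i: "i \<le> n" "l = \<iota> i" using bij by (metis UNIV_I atLeastAtMost_iff bij_betw_imp_surj_on imageE)
    have "x A (n - i) = X $ (A, l)"
      using i by (simp add: x_def pd_tw_low if_distrib[of "\<lambda>y. _ * y"] cong: if_cong)
    with x show ?thesis by simp
  qed
  then show ?thesis by (simp add: vec_eq_iff)
qed

text \<open>On the slice \<open>\<Sigma>\<close> takes the values \<open>\<pi>\<^sub>0\<^sub>'\<^sup>2\<^sup>n\<close> on \<open>e\<^sub>0\<^sub>0, e\<^sub>1\<^sub>0\<close> and
  \<open>\<pi>\<^sub>0\<^sub>'\<^sup>2\<^sup>n\<^sup>-\<^sup>1 \<pi>\<^sub>1\<^sub>'\<close> on \<open>e\<^sub>0\<^sub>0, e\<^sub>1\<^sub>1\<close>; no non-zero linear vector field in \<open>\<pi>\<close> annihilates both.\<close>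

lemma fibre_part_nondegenerate:
  fixes f :: "2 \<Rightarrow> 2 \<Rightarrow> complex"
  assumes p: "p \<in> U" and zero: "\<And>\<pi> a b. snd a \<in> {\<iota> 0, \<iota> 1} \<Longrightarrow> snd b \<in> {\<iota> 0, \<iota> 1} \<Longrightarrow>
     (\<Sum>A'\<in>UNIV. \<Sum>B'\<in>UNIV. f A' B' * \<pi> $ A' * pd B' (\<lambda>\<rho>. Sigma_form n \<iota> \<Theta> \<rho> p a b) \<pi>) = 0"
  shows "f A' B' = 0"
proof -
  define d where "d k \<pi> = (\<Sum>A'\<in>UNIV. \<Sum>B'\<in>UNIV. f A' B' * \<pi> $ A' * pd B' (fibre_monomial n k) \<pi>)" for k \<pi>
  have z: "(\<Sum>k\<le>2*n. d k \<pi> * \<sigma> k p a b) = 0" if "snd a \<in> {\<iota> 0, \<iota> 1}" "snd b \<in> {\<iota> 0, \<iota> 1}" for \<pi> a b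
    using zero[OF that, of \<pi>]
    by (simp add: d_def pd_Sigma_form sum_two sum_distrib_left sum_distrib_right sum.distrib algebra_simps)
  have d1: "d (2 * n) \<pi> = 0" for \<pi>
    using z[of "(0, \<iota> 0)" "(1, \<iota> 0)" \<pi>] by (simp add: Sigma_frame_00 if_distrib[of "\<lambda>y. _ * y"] cong: if_cong)
  \<comment> \<open>Evaluation on \<open>e\<^sub>0\<^sub>0, e\<^sub>1\<^sub>1\<close> isolates the
    coefficient of order \<open>2 * n - 1\<close>, as
    \<open>e\<^sub>0\<^sub>0, e\<^sub>1\<^sub>0\<close> did the top one.\<close>
  have "E 1 p (\<lambda>b. \<Sum>k\<le>2*n. d k \<pi> * \<sigma> k p (0, \<iota> 0) b) = 0" for \<pi>
    unfolding contract_frame_def using z by simp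
  then have d2: "d (2 * n - 1) \<pi> = 0" for \<pi>
    by (simp add: contract_frame_sum contract_frame_cmult Sigma_frame_01[OF _ p] if_distrib[of "\<lambda>y. _ * y"] cong: if_cong)
  have m1: "fibre_monomial n (2 * n) = (\<lambda>\<pi>. \<pi> $ 0 ^ (2 * n))"
    by (simp add: fibre_monomial_def fun_eq_iff)
  have m2: "fibre_monomial n (2 * n - 1) = (\<lambda>\<pi>. \<pi> $ 0 ^ (2 * n - 1) * \<pi> $ 1)"
    using n by (simp add: fibre_monomial_def fun_eq_iff)
  have pd1: "pd B' (fibre_monomial n (2 * n)) \<pi> = (if B' = 0 then of_nat (2 * n) * \<pi> $ 0 ^ (2 * n - 1) else 0)" for B' \<pi>
    unfolding m1 by (subst pd_power[OF holo_on_coord[of _ UNIV]]) (auto simp: pd_coord)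
  have pd2: "pd 1 (fibre_monomial n (2 * n - 1)) \<pi> = \<pi> $ 0 ^ (2 * n - 1)" for \<pi>
    unfolding m2
    by (subst pd_mult[where U = UNIV]) 
       (auto intro!: holo_intros simp: pd_power[OF holo_on_coord[of _ UNIV]] pd_coord)
  \<comment> \<open>The point (1, 0) of the fibre isolates \<open>f 0 0\<close>; the point (1, 1)
    then yields \<open>f 1 0\<close>. The same two points serve for \<open>f1\<close>.\<close>
  have f0: "f A' 0 = 0" for A'
    using d1[of "\<chi> i. if i = 0 then 1 else 0"] d1[of "\<chi> i. 1"] n two_cases[of A']
    by (auto simp: d_def sum_two pd1)
  have f1: "f A' 1 = 0" for A'
    using d2[of "\<chi> i. if i = 0 then 1 else 0"] d2[of "\<chi> i. 1"] n two_cases[of A']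
    by (auto simp: d_def sum_two f0 pd2[simplified])
  show ?thesis using two_cases[of B'] f0 f1 by auto
qed

text \<open>By the shift, \<Sigma> on \<open>e\<^sub>A\<^sub>0, e\<^sub>B\<^sub>1\<close> equals the
  previous coefficient on \<open>e\<^sub>A\<^sub>1, e\<^sub>B\<^sub>1\<close>, which is skew in
  \<open>A, B\<close>. This will remove the \<phi> terms after symmetrisation.\<close>

lemma Sigma_double_contract:
  assumes "p \<in> U" "k \<le> 2 * n"
  shows "E B p (\<lambda>b. \<sigma> k p (A, \<iota> 0) b) + E A p (\<lambda>b. \<sigma> k p (B, \<iota> 0) b) = 0"
proof (cases k)
  case 0
  then show ?thesis using Sigma_0[OF assms(1)] by simp
next
  case (Suc j)
  then have j: "j \<le> 2 * n" using assms by simp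
  have "E A p (\<lambda>b. E B p (\<lambda>a. \<sigma> j p a b)) = E B p (\<lambda>a. E A p (\<lambda>b. \<sigma> j p a b))"
    by (rule contract_frame_swap)
  also have "\<dots> = E B p (\<lambda>a. - E A p (\<lambda>b. \<sigma> j p b a))"
    by (subst Sigma_antisym) (simp add: contract_frame_minus)
  finally show ?thesis
    using Suc assms(1) j by (simp add: Sigma_shift contract_frame_minus)
qed

end

section \<open>The one-form \<open>K \<lrcorner> \<Sigma>\<close> and the symmetry condition\<close>

locale symmetric_hierarchy = hierarchy n \<iota> U \<Theta> 
  for n :: nat and \<iota> :: "nat \<Rightarrow> 'm::finite" and U and \<Theta> +
  fixes K :: "complex ^ (2 \<times> 'm) \<Rightarrow> complex ^ (2 \<times> 'm)" and \<phi> :: "complex ^ (2 \<times> 'm) \<Rightarrow> 2 \<Rightarrow> 2 \<Rightarrow> complex"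
  assumes holo_K: "\<And>c. holo_on (\<lambda>p. K p $ c) U"
    and holo_phi: "\<And>A' B'. holo_on (\<lambda>p. \<phi> p A' B') U"
    and lie: "\<And>p \<pi> a b. p \<in> U \<Longrightarrow> lie_lift_Sigma n \<iota> \<Theta> K \<phi> \<pi> p a b = 0"
begin

definition interior_product :: "nat \<Rightarrow> 2 \<times> 'm \<Rightarrow> complex ^ (2 \<times> 'm) \<Rightarrow> complex" where
  "interior_product k b p = (\<Sum>c\<in>UNIV. K p $ c * \<sigma> k p c b)"

text \<open>Up to raising an index and normalising, these are the coefficients of the sought spinor.
  They vanish for \<open>k = 0\<close> and \<open>k = 2 * n + 1\<close>; the remaining
  \<open>2 * n\<close> values match a polynomial of degree \<open>2 * n - 1\<close> in
  \<pi>.\<close>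

definition potential :: "2 \<Rightarrow> nat \<Rightarrow> complex ^ (2 \<times> 'm) \<Rightarrow> complex" where
  "potential B k = interior_product k (B, \<iota> 0)"

lemma holo_interior_product: "holo_on (interior_product k b) U"
  unfolding interior_product_def[abs_def] by (intro holo_intros holo_K holo_Sigma)

lemma holo_potential: "holo_on (potential B k) U"
  unfolding potential_def by (rule holo_interior_product)

text \<open>The kernel relation \<open>Sigma_shift\<close>, used in the free slot of \<Sigma>. Hence
  the potentials determine the one-form on all vectors tangent to the slice.\<close>

lemma interior_product_contract:
  assumes "p \<in> U" "k \<le> 2 * n"
  shows "E B p (\<lambda>b. interior_product k b p) = potential B (Suc k) p"
proof -
  have "E B p (\<lambda>b. interior_product k b p) = (\<Sum>c\<in>UNIV. K p $ c * E B p (\<lambda>b. - \<sigma> k p b c))"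
    unfolding interior_product_def contract_frame_sum contract_frame_cmult 
    by (subst Sigma_antisym) simp
  also have "\<dots> = (\<Sum>c\<in>UNIV. K p $ c * - \<sigma> (Suc k) p (B, \<iota> 0) c)"
    using assms by (simp add: contract_frame_minus Sigma_shift)
  also have "\<dots> = potential B (Suc k) p"
    unfolding potential_def interior_product_def by (subst (2) Sigma_antisym) simp
  finally show ?thesis .
qed

lemma potential_0: "p \<in> U \<Longrightarrow> potential B 0 p = 0"
  unfolding potential_def interior_product_def using Sigma_antisym[of 0 p _ "(B, \<iota> 0)"] by (simp add: Sigma_0)

lemma potential_top: "p \<in> U \<Longrightarrow> potential B (Suc (2 * n)) p = 0"
  unfolding potential_def interior_product_def using Sigma_top[of p] by simp

lemma lie_Sigma_coeff:
  assumes "p \<in> U"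
  shows "lie_2form K (\<sigma> k) p a b = pd a (interior_product k b) p - pd b (interior_product k a) p"
  unfolding interior_product_def[abs_def]
  by (rule lie_2form_closed[OF U assms holo_K holo_Sigma Sigma_antisym Sigma_closed[OF assms]])

text \<open>The symmetry condition makes the Lie derivative along \<open>K\<close> minus the \<phi>
  term, a combination of the \<open>\<sigma> k\<close>; symmetrised, it dies by
  \<open>Sigma_double_contract\<close>. Independence of the monomials gives the claim for each
  \<open>k\<close>.\<close>

lemma lie_Sigma_coeff_contract:
  assumes p: "p \<in> U" and k: "k \<le> 2 * n"
  shows "E B p (\<lambda>b. lie_2form K (\<sigma> k) p (A, \<iota> 0) b) + E A p (\<lambda>b. lie_2form K (\<sigma> k) p (B, \<iota> 0) b) = 0"
proof -
  define X where "X k = E B p (\<lambda>b. lie_2form K (\<sigma> k) p (A, \<iota> 0) b) + E A p (\<lambda>b. lie_2form K (\<sigma> k) p (B, \<iota> 0) b)" for k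
  have "(\<Sum>k\<le>2*n. fibre_monomial n k \<pi> * X k) = 0" for \<pi>
  proof -
    \<comment> \<open>These coefficients mix several monomials in \<pi>, so orders are compared only
      after the \<phi> part is gone.\<close>
    define d where "d k = (\<Sum>A'\<in>UNIV. \<Sum>B'\<in>UNIV. \<phi> p A' B' * \<pi> $ A' * pd B' (fibre_monomial n k) \<pi>)" for k
    have F: "Sigma_form n \<iota> \<Theta> \<pi> = (\<lambda>q a b. \<Sum>k\<le>2*n. fibre_monomial n k \<pi> * \<sigma> k q a b)"
      by (intro ext) (rule Sigma_form_monomials)
    have "lie_2form K (Sigma_form n \<iota> \<Theta> \<pi>) p a b = (\<Sum>k\<le>2*n. fibre_monomial n k \<pi> * lie_2form K (\<sigma> k) p a b)" for a b
      unfolding F by (rule lie_2form_lincomb[OF p holo_Sigma])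
    moreover have "(\<Sum>A'\<in>UNIV. \<Sum>B'\<in>UNIV. \<phi> p A' B' * \<pi> $ A' * pd B' (\<lambda>\<rho>. Sigma_form n \<iota> \<Theta> \<rho> p a b) \<pi>)
       = (\<Sum>k\<le>2*n. d k * \<sigma> k p a b)" for a b
      by (simp add: d_def pd_Sigma_form sum_two sum_distrib_left sum_distrib_right sum.distrib algebra_simps)
    ultimately have "(\<Sum>k\<le>2*n. fibre_monomial n k \<pi> * lie_2form K (\<sigma> k) p a b) + (\<Sum>k\<le>2*n. d k * \<sigma> k p a b) = 0" for a b
      using lie[OF p, of \<pi> a b] by (simp add: lie_lift_Sigma_def)
    then have "E B p (\<lambda>b. (\<Sum>k\<le>2*n. fibre_monomial n k \<pi> * lie_2form K (\<sigma> k) p (A, \<iota> 0) b) + (\<Sum>k\<le>2*n. d k * \<sigma> k p (A, \<iota> 0) b))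
      + E A p (\<lambda>b. (\<Sum>k\<le>2*n. fibre_monomial n k \<pi> * lie_2form K (\<sigma> k) p (B, \<iota> 0) b) + (\<Sum>k\<le>2*n. d k * \<sigma> k p (B, \<iota> 0) b)) = 0"
      by simp
    then have "(\<Sum>k\<le>2*n. fibre_monomial n k \<pi> * X k) + 
       (\<Sum>k\<le>2*n. d k * (E B p (\<lambda>b. \<sigma> k p (A, \<iota> 0) b) + E A p (\<lambda>b. \<sigma> k p (B, \<iota> 0) b))) = 0"
      by (simp add: X_def contract_frame_add contract_frame_sum contract_frame_cmult sum.distrib distrib_left add_ac)
    moreover have "(\<Sum>k\<le>2*n. d k * (E B p (\<lambda>b. \<sigma> k p (A, \<iota> 0) b) + E A p (\<lambda>b. \<sigma> k p (B, \<iota> 0) b))) = 0"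
      by (rule sum.neutral) (simp add: Sigma_double_contract[OF p])
    ultimately show ?thesis by simp
  qed
  from fibre_monomials_independent[OF this k] show ?thesis by (simp add: X_def)
qed

definition killing_term :: "2 \<Rightarrow> 2 \<Rightarrow> nat \<Rightarrow> complex ^ (2 \<times> 'm) \<Rightarrow> complex" where
  "killing_term A B k p = pd (A, \<iota> 0) (potential B (Suc k)) p - E B p (\<lambda>b. pd b (potential A k) p)
     - (\<Sum>D\<in>UNIV. pd (A, \<iota> 0) (H B D) p * potential D k p)"

text \<open>Differentiate \<open>interior_product_contract\<close> along
  \<open>\<partial>\<^sub>A\<^sub>0\<close>. The derivative of \<open>e\<^sub>B\<^sub>1\<close>
  itself produces the terms in \<open>pd (A, \<iota> 0) (H B D)\<close>, which become the spin
  connection on the slice.\<close>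

lemma killing_term_lie:
  assumes p: "p \<in> U" and k: "k \<le> 2 * n"
  shows "E B p (\<lambda>b. lie_2form K (\<sigma> k) p (A, \<iota> 0) b) = killing_term A B k p"
proof -
  have "pd (A, \<iota> 0) (potential B (Suc k)) p = pd (A, \<iota> 0) (\<lambda>q. E B q (\<lambda>b. interior_product k b q)) p"
    by (rule pd_cong[OF U p]) (simp add: interior_product_contract k)
  also have "\<dots> = E B p (\<lambda>b. pd (A, \<iota> 0) (interior_product k b) p) + (\<Sum>D\<in>UNIV. pd (A, \<iota> 0) (H B D) p * potential D k p)"
    using p by (simp add: contract_frame_def sum_two potential_def pd_add[where U = U] pd_mult[where U = U]
        holo_interior_product holo_H holo_intros algebra_simps)
  finally show ?thesis
    by (simp add: killing_term_def lie_Sigma_coeff[OF p] contract_frame_diff potential_def)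
qed

lemma killing_term_antisym: "p \<in> U \<Longrightarrow> k \<le> 2 * n \<Longrightarrow> killing_term A B k p + killing_term B A k p = 0"
  using lie_Sigma_coeff_contract[of p k B A] by (simp add: killing_term_lie)

end

section \<open>Slices\<close>

lemma slice_emb_line:
  assumes "\<iota> 0 \<noteq> \<iota> 1"
  shows "slice_emb \<iota> c (p + t *s axis (A, 0) 1) = slice_emb \<iota> c p + t *s axis (A, \<iota> 0) 1"
    and "slice_emb \<iota> c (p + t *s axis (A, 1) 1) = slice_emb \<iota> c p + t *s axis (A, \<iota> 1) 1"
  using assms by (auto simp: slice_emb_def vec_eq_iff axis_def)

lemma pd_slice:
  assumes "\<iota> 0 \<noteq> \<iota> 1"
  shows "pd (A, 0) (\<lambda>p. f (slice_emb \<iota> c p)) p = pd (A, \<iota> 0) f (slice_emb \<iota> c p)"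
    and "pd (A, 1) (\<lambda>p. f (slice_emb \<iota> c p)) p = pd (A, \<iota> 1) f (slice_emb \<iota> c p)"
  unfolding pd_def slice_emb_line[OF assms] by (rule refl)+

text \<open>The embedding is affine, and taking the constants \<open>c\<close> to be zero gives its
  linear part.\<close>

lemma slice_emb_has_derivative:
  "(slice_emb \<iota> c has_derivative slice_emb \<iota> 0) (at p)"
proof -
  have eq: "slice_emb \<iota> c = (\<lambda>p. slice_emb \<iota> 0 p + slice_emb \<iota> c 0)"
    by (auto simp: slice_emb_def vec_eq_iff fun_eq_iff)
  have "linear (slice_emb \<iota> 0)"
    by (rule linearI) (auto simp: slice_emb_def vec_eq_iff)
  then have "bounded_linear (slice_emb \<iota> 0)" by (rule linear_conv_bounded_linear[THEN iffD1])
  then have "(slice_emb \<iota> 0 has_derivative slice_emb \<iota> 0) (at p)"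
    by (rule bounded_linear_imp_has_derivative)
  then show ?thesis by (subst eq) (rule has_derivative_add_const)
qed

lemma slice_emb_smult: "slice_emb \<iota> 0 (t *s v) = t *s slice_emb \<iota> 0 v"
  by (auto simp: slice_emb_def vec_eq_iff)

lemma open_slice: "open U \<Longrightarrow> open (slice \<iota> c U)"
proof -
  assume "open U"
  have "continuous_on UNIV (slice_emb \<iota> c)"
    by (auto intro!: continuous_at_imp_continuous_on has_derivative_continuous[OF slice_emb_has_derivative])
  with \<open>open U\<close> have "open (slice_emb \<iota> c -` U)" by (simp add: open_vimage)
  then show ?thesis by (simp add: slice_def vimage_def)
qed

lemma holo_on_slice:
  assumes "holo_on f U"
  shows "holo_on (\<lambda>p. f (slice_emb \<iota> c p)) (slice \<iota> c U)"
  unfolding holo_on_def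
proof
  fix p assume "p \<in> slice \<iota> c U"
  then obtain f' where f': "(f has_derivative f') (at (slice_emb \<iota> c p))" "\<And>t v. f' (t *s v) = t * f' v"
    using assms unfolding holo_on_def slice_def by blast
  have "((\<lambda>p. f (slice_emb \<iota> c p)) has_derivative (\<lambda>h. f' (slice_emb \<iota> 0 h))) (at p)"
    using diff_chain_at[OF slice_emb_has_derivative f'(1)] by (simp add: o_def)
  then show "\<exists>f'. ((\<lambda>p. f (slice_emb \<iota> c p)) has_derivative f') (at p) \<and> (\<forall>t v. f' (t *s v) = t * f' v)"
    by (intro exI[of _ "\<lambda>h. f' (slice_emb \<iota> 0 h)"]) (simp add: slice_emb_smult f'(2))
qed

context symmetric_hierarchy
begin

lemma iota_01: "\<iota> 0 \<noteq> \<iota> 1"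
  using iota_eq[of 0 1] n by simp

section \<open>Vanishing of a symmetry to infinite order along a slice\<close>

text \<open>The leading part of the symmetry condition after \<open>r\<close> differentiations:
  undifferentiated \<open>K\<close> contributes nothing, and in the other products all derivatives
  must fall on \<open>pd a K\<close>, \<open>pd b K\<close> or \<phi>.\<close>

lemma lie_jet:
  assumes Z: "Z \<subseteq> U" "p \<in> Z" and I: "length I = r"
    and vK: "\<And>c. vanishes_to (Suc r) Z (\<lambda>q. K q $ c)" and vphi: "\<And>A' B'. vanishes_to r Z (\<lambda>q. \<phi> q A' B')"
  shows "(\<Sum>d\<in>UNIV. pds I (pd a (\<lambda>q. K q $ d)) p * Sigma_form n \<iota> \<Theta> \<pi> p d b
      + pds I (pd b (\<lambda>q. K q $ d)) p * Sigma_form n \<iota> \<Theta> \<pi> p a d)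
      + (\<Sum>A'\<in>UNIV. \<Sum>B'\<in>UNIV. pds I (\<lambda>q. \<phi> q A' B') p * \<pi> $ A' * pd B' (\<lambda>\<rho>. Sigma_form n \<iota> \<Theta> \<rho> p a b) \<pi>) = 0"
proof -
  have p: "p \<in> U" using Z by auto
  let ?S = "\<lambda>a b q. Sigma_form n \<iota> \<Theta> \<pi> q a b"
  let ?R = "\<lambda>B' q. pd B' (\<lambda>\<rho>. Sigma_form n \<iota> \<Theta> \<rho> q a b) \<pi>"
  have hS: "holo_on (?S a b) U" for a b
    unfolding Sigma_form_monomials by (intro holo_intros holo_Sigma)
  have hR: "holo_on (?R B') U" for B'
    unfolding pd_Sigma_form by (intro holo_intros holo_Sigma)
  note h = holo_K holo_phi hS hR holo_on_pd[OF U hS] holo_on_pd[OF U holo_K]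
  have "lie_lift_Sigma n \<iota> \<Theta> K \<phi> \<pi> q a b = 
    (\<Sum>d\<in>UNIV. K q $ d * pd d (?S a b) q + (pd a (\<lambda>q. K q $ d) q * ?S d b q + pd b (\<lambda>q. K q $ d) q * ?S a d q))
     + (\<Sum>A'\<in>UNIV. \<Sum>B'\<in>UNIV. \<phi> q A' B' * (\<pi> $ A' * ?R B' q))" for q
    by (simp add: lie_lift_Sigma_def lie_2form_def algebra_simps)
  note expand = this
  have "pds I (\<lambda>q. (\<Sum>d\<in>UNIV. K q $ d * pd d (?S a b) q + (pd a (\<lambda>q. K q $ d) q * ?S d b q + pd b (\<lambda>q. K q $ d) q * ?S a d q))
     + (\<Sum>A'\<in>UNIV. \<Sum>B'\<in>UNIV. \<phi> q A' B' * (\<pi> $ A' * ?R B' q))) p = pds I (\<lambda>q. 0) p"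
    by (rule pds_cong[OF U p]) (simp only: expand[symmetric] lie)
  moreover have "pds I (\<lambda>q. K q $ d * pd d (?S a b) q) p = 0" for d
  proof -
    have "pds I (\<lambda>q. K q $ d * pd d (?S a b) q) p = pds I (\<lambda>q. K q $ d) p * pd d (?S a b) p"
      by (rule pds_mult_vanishes[OF U _ _ Z vK]) (simp_all add: h I)
    moreover have "pds I (\<lambda>q. K q $ d) p = 0"
      using vK[of d] Z(2) I unfolding vanishes_to_def by auto
    ultimately show ?thesis by simp
  qed
  moreover have "pds I (\<lambda>q. pd a (\<lambda>q. K q $ d) q * ?S b c q) p = pds I (pd a (\<lambda>q. K q $ d)) p * ?S b c p" for a b c d
    by (rule pds_mult_vanishes[OF U _ _ Z vanishes_to_pd[OF vK]]) (simp_all add: h I)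
  moreover have "pds I (\<lambda>q. \<phi> q A' B' * (\<pi> $ A' * ?R B' q)) p = pds I (\<lambda>q. \<phi> q A' B') p * (\<pi> $ A' * ?R B' p)" for A' B'
    by (rule pds_mult_vanishes[OF U _ _ Z vphi]) (simp_all add: h I holo_intros)
  ultimately show ?thesis
    by (simp add: pds_add[OF U p] pds_sum[OF U p] h holo_intros pds_zero mult.assoc)
qed

lemma slice_tangent_derivative:
  assumes "\<And>q. q \<in> slice \<iota> c U \<Longrightarrow> f (slice_emb \<iota> c q) = 0" "p \<in> slice \<iota> c U" "snd a \<in> {\<iota> 0, \<iota> 1}"
  shows "pd a f (slice_emb \<iota> c p) = 0"
proof -
  have "pd b (\<lambda>q. f (slice_emb \<iota> c q)) p = pd b (\<lambda>q. 0) p" for b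
    by (rule pd_cong[OF open_slice[OF U] assms(2,1)])
  with pd_slice[OF iota_01, where c = c and f = f and p = p and A = "fst a"] assms(3) show ?thesis
    by (cases a) auto
qed

text \<open>Induction with \<phi> one order behind \<open>K\<close>: each step first gains an order
  for \<phi> from directions tangent to the slice, then an order for \<open>K\<close> in all
  directions.\<close>

lemma infinite_order_vanishing:
  assumes zero: "\<And>p. p \<in> slice \<iota> c U \<Longrightarrow> K (slice_emb \<iota> c p) = 0"
  defines "Z \<equiv> slice_emb \<iota> c ` slice \<iota> c U"
  shows "(\<forall>d. vanishes_to (Suc r) Z (\<lambda>q. K q $ d)) \<and> (\<forall>A' B'. vanishes_to r Z (\<lambda>q. \<phi> q A' B'))"
proof (induction r)
  case 0
  show ?case using zero by (auto simp: vanishes_to_def Z_def)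
next
  case (Suc r)
  then have vK: "\<And>d. vanishes_to (Suc r) Z (\<lambda>q. K q $ d)" and vphi: "\<And>A' B'. vanishes_to r Z (\<lambda>q. \<phi> q A' B')"
    by auto
  have Z: "Z \<subseteq> U" by (auto simp: Z_def slice_def)
  have tangent: "pds I (pd a (\<lambda>q. K q $ d)) z = 0" 
    if z: "z \<in> Z" and I: "length I = r" and a: "snd a \<in> {\<iota> 0, \<iota> 1}" for z I a d
  proof -
    obtain p where p: "p \<in> slice \<iota> c U" "z = slice_emb \<iota> c p" using z by (auto simp: Z_def)
    have "pds I (\<lambda>q. K q $ d) (slice_emb \<iota> c q) = 0" if "q \<in> slice \<iota> c U" for q
      using vK[of d] that I unfolding vanishes_to_def Z_def by auto
    then have "pd a (pds I (\<lambda>q. K q $ d)) (slice_emb \<iota> c p) = 0"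
      by (rule slice_tangent_derivative[where c = c and f = "pds I (\<lambda>q. K q $ d)", OF _ p(1) a])
    then show ?thesis
      using pds_pd[OF U _ holo_K, of z I a d] z Z p(2) by auto
  qed
  \<comment> \<open>With \<open>a\<close> and \<open>b\<close> both tangent, the \<open>K\<close>
    terms of \<open>lie_jet\<close> vanish and only a linear vector field in \<pi> acting on
    \<Sigma> is left.\<close>
  have phi0: "pds I (\<lambda>q. \<phi> q A' B') z = 0" if z: "z \<in> Z" and I: "length I = r" for z I A' B'
  proof (rule fibre_part_nondegenerate[where p = z and f = "\<lambda>A' B'. pds I (\<lambda>q. \<phi> q A' B') z"])
    show "z \<in> U" using z Z by auto
    fix \<pi> :: "complex ^ 2" and a b :: "2 \<times> 'm" assume "snd a \<in> {\<iota> 0, \<iota> 1}" "snd b \<in> {\<iota> 0, \<iota> 1}"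
    then show "(\<Sum>A'\<in>UNIV. \<Sum>B'\<in>UNIV. pds I (\<lambda>q. \<phi> q A' B') z * \<pi> $ A' * pd B' (\<lambda>\<rho>. Sigma_form n \<iota> \<Theta> \<rho> z a b) \<pi>) = 0"
      using lie_jet[OF Z z I vK vphi, of a \<pi> b] tangent[OF z I] by simp
  qed
  then have vphi': "vanishes_to (Suc r) Z (\<lambda>q. \<phi> q A' B')" for A' B'
    by (intro vanishes_to_SucI vphi)
  \<comment> \<open>Now only \<open>a\<close> is tangent and \<open>b\<close> is arbitrary: the jet
    of \<open>K\<close> in direction \<open>b\<close>, contracted with \<Sigma> and
    \<open>\<partial>\<^sub>A\<^sub>0\<close>, is zero, so \<open>Sigma_nondegenerate\<close>
    applies.\<close>
  have K0: "pds I (pd b (\<lambda>q. K q $ d)) z = 0" if z: "z \<in> Z" and I: "length I = r" for z I b d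
  proof -
    have zU: "z \<in> U" using z Z by auto
    define Y where "Y = (\<chi> d. pds I (pd b (\<lambda>q. K q $ d)) z)"
    have S: "(\<Sum>d\<in>UNIV. Y $ d * Sigma_form n \<iota> \<Theta> \<pi> z (A, \<iota> 0) d) = 0" for \<pi> A
      using lie_jet[OF Z z I vK vphi, of "(A, \<iota> 0)" \<pi> b] tangent[OF z I, of "(A, \<iota> 0)"] phi0[OF z I]
      by (simp add: Y_def)
    have "(\<Sum>d\<in>UNIV. Y $ d * \<sigma> k z d (A, \<iota> 0)) = 0" if "k \<le> 2 * n" for k A
    proof -
      have "(\<Sum>k\<le>2*n. fibre_monomial n k \<pi> * (\<Sum>d\<in>UNIV. Y $ d * \<sigma> k z (A, \<iota> 0) d)) = 
         (\<Sum>d\<in>UNIV. Y $ d * Sigma_form n \<iota> \<Theta> \<pi> z (A, \<iota> 0) d)" for \<pi>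
        unfolding Sigma_form_monomials sum_distrib_left by (subst sum.swap) (simp add: mult_ac)
      then have "(\<Sum>k\<le>2*n. fibre_monomial n k \<pi> * (\<Sum>d\<in>UNIV. Y $ d * \<sigma> k z (A, \<iota> 0) d)) = 0" for \<pi>
        by (simp add: S)
      from fibre_monomials_independent[OF this that]
      have "(\<Sum>d\<in>UNIV. Y $ d * \<sigma> k z (A, \<iota> 0) d) = 0" .
      then show ?thesis
        by (subst Sigma_antisym) (simp add: sum_negf)
    qed
    from Sigma_nondegenerate[OF zU this] have "Y = 0" .
    then have "Y $ d = 0" by simp
    then show ?thesis by (simp add: Y_def)
  qed
  have "vanishes_to (Suc (Suc r)) Z (\<lambda>q. K q $ d)" for d
  proof (rule vanishes_to_SucI[OF vK])
    fix J :: "(2 \<times> 'm) list" and z assume J: "length J = Suc r" "z \<in> Z"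
    then obtain b I where "J = b # I" "length I = r" by (cases J) auto
    with K0 J show "pds J (\<lambda>q. K q $ d) z = 0" by simp
  qed
  with vphi' show ?case by blast
qed

text \<open>A symmetry zero on the slice would be zero on the connected \<open>U\<close>. At a point
  of the slice with \<open>K\<close> non-zero, non-degeneracy gives a non-zero potential, and its
  order is not 0 by \<open>potential_0\<close>.\<close>

lemma potential_nonzero_on_slice:
  assumes "connected U" "\<exists>p\<in>U. K p \<noteq> 0" "slice \<iota> c U \<noteq> {}"
  obtains p B k where "p \<in> slice \<iota> c U" "k < 2 * n" "potential B (Suc k) (slice_emb \<iota> c p) \<noteq> 0"
proof -
  have "\<exists>p\<in>slice \<iota> c U. K (slice_emb \<iota> c p) \<noteq> 0"
  proof (rule ccontr)
    assume "\<not> ?thesis"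
    then have zero: "K (slice_emb \<iota> c p) = 0" if "p \<in> slice \<iota> c U" for p using that by blast
    obtain p where p: "p \<in> slice \<iota> c U" using assms(3) by auto
    have v: "pds I (\<lambda>q. K q $ d) (slice_emb \<iota> c p) = 0" for I d
    proof -
      have "vanishes_to (Suc (length I)) (slice_emb \<iota> c ` slice \<iota> c U) (\<lambda>q. K q $ d)"
        using infinite_order_vanishing[OF zero] by blast
      with p show ?thesis unfolding vanishes_to_def by blast
    qed
    have "slice_emb \<iota> c p \<in> U" using p by (simp add: slice_def)
    from holo_on_identity_theorem[OF U assms(1) this holo_K v]
    have "K q = 0" if "q \<in> U" for q using that by (simp add: vec_eq_iff)
    with assms(2) show False by blast
  qed
  then obtain p where p: "p \<in> slice \<iota> c U" "K (slice_emb \<iota> c p) \<noteq> 0" by blast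
  then have pU: "slice_emb \<iota> c p \<in> U" by (simp add: slice_def)
  from p(2) obtain k B where k: "k \<le> 2 * n" "potential B k (slice_emb \<iota> c p) \<noteq> 0"
    using Sigma_nondegenerate[OF pU] unfolding potential_def interior_product_def by blast
  then have "k \<noteq> 0" using potential_0[OF pU] by metis
  then obtain j where j: "k = Suc j" by (cases k) auto
  show ?thesis by (rule that[OF p(1), of j B]) (use k j in auto)
qed

end

section \<open>The Levi-Civita connection of the heavenly metric\<close>

lemma sum_UNIV_prod:
  "(\<Sum>a\<in>UNIV. f a) = (\<Sum>A\<in>UNIV. \<Sum>i\<in>UNIV. f (A, i))" for f :: "'a::finite \<times> 'b::finite \<Rightarrow> 'c::comm_monoid_add"
  by (simp add: UNIV_Times_UNIV[symmetric] sum.cartesian_product del: UNIV_Times_UNIV)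

lemma sum_coords:
  "(\<Sum>a\<in>UNIV. f a) = f (0, 0) + f (0, 1) + f (1, 0) + f (1, 1)" for f :: "2 \<times> 2 \<Rightarrow> 'c::comm_monoid_add"
  by (simp add: sum_UNIV_prod sum_two add.assoc)

lemma all_two: "(\<forall>A::2. P A) \<longleftrightarrow> P 0 \<and> P 1"
  using two_cases by metis

lemma all_coords: "(\<forall>a::2\<times>2. P a) \<longleftrightarrow> P (0, 0) \<and> P (0, 1) \<and> P (1, 0) \<and> P (1, 1)"
  by (auto simp: split_paired_all all_two)

lemma eps_simps [simp]: "eps 0 0 = 0" "eps 0 1 = 1" "eps 1 0 = -1" "eps 1 1 = 0"
  by (simp_all add: eps_def)

definition hess :: "(point \<Rightarrow> complex) \<Rightarrow> 2 \<Rightarrow> 2 \<Rightarrow> point \<Rightarrow> complex" where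
  "hess \<theta> A B = pd (A, 0) (pd (B, 0) \<theta>)"

definition hamil :: "(point \<Rightarrow> complex) \<Rightarrow> 2 \<Rightarrow> 2 \<Rightarrow> point \<Rightarrow> complex" where
  "hamil \<theta> A C p = (if C = 0 then hess \<theta> 1 A p else - hess \<theta> 0 A p)"

lemma heavenly_tetrad_nth:
  "heavenly_tetrad \<theta> A A' p $ (C, i) =
     (if A' = 0 then (if C = A \<and> i = 0 then 1 else 0)
      else if i = 0 then hamil \<theta> A C p else if C = A then 1 else 0)"
  using two_cases[of C] two_cases[of i]
  by (auto simp: heavenly_tetrad_def hamil_def hess_def dX_def dY_def axis_def)

lemma metric_matrix_heavenly:
  "metric_matrix (heavenly_metric \<theta>) q $ (A, i) $ (B, j) =
     (if i = 0 \<and> j = 0 then 0 else if i = 0 then eps A B else if j = 0 then eps B A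
      else - 2 * (if A = B then hess \<theta> A B q else hess \<theta> 0 1 q))"
  using two_cases[of A] two_cases[of B] two_cases[of i] two_cases[of j]
  by (auto simp: metric_matrix_def heavenly_metric_def Let_def axis_def hess_def)

text \<open>In blocks: the metric is zero on the \<open>\<partial>\<^sub>A\<^sub>0\<close>, which it
  pairs with the \<open>\<partial>\<^sub>A\<^sub>1\<close> through \<open>eps\<close>. So the
  inverse has a zero block at second indices 1, 1 and the adjugate of twice the Hessian at 0,
  0.\<close>

definition inverse_metric :: "(point \<Rightarrow> complex) \<Rightarrow> point \<Rightarrow> complex ^ (2 \<times> 2) ^ (2 \<times> 2)" where
  "inverse_metric \<theta> q = (\<chi> a b. 
     if snd a = 1 \<and> snd b = 1 then 0 else if snd b = 1 then eps (fst a) (fst b)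
     else if snd a = 1 then - eps (fst a) (fst b)
     else if fst a \<noteq> fst b then -2 * hess \<theta> 0 1 q 
     else if fst a = 0 then 2 * hess \<theta> 1 1 q else 2 * hess \<theta> 0 0 q)"

lemma matrix_inv_heavenly:
  "matrix_inv (metric_matrix (heavenly_metric \<theta>) q) = inverse_metric \<theta> q"
proof -
  let ?A = "metric_matrix (heavenly_metric \<theta>) q"
  have "?A ** inverse_metric \<theta> q = mat 1"
    by (simp add: vec_eq_iff matrix_matrix_mult_def sum_coords all_coords metric_matrix_heavenly
       inverse_metric_def mat_def del: split_paired_All)
  moreover from this have "inverse_metric \<theta> q ** ?A = mat 1"
    by (simp add: matrix_left_right_inverse)
  ultimately show ?thesis
    unfolding matrix_inv_def
    by (intro some_equality conjI) (metis matrix_mul_assoc matrix_mul_lid matrix_mul_rid)+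
qed

locale heavenly_space =
  fixes \<theta> :: "point \<Rightarrow> complex" and M :: "point set"
  assumes M: "open M" and holo: "holo_on \<theta> M"
    and heavenly: "\<And>p. p \<in> M \<Longrightarrow> pd (0, 1) (pd (1, 0) \<theta>) p - pd (1, 1) (pd (0, 0) \<theta>) p
        + poisson_yx 0 (pd (0, 0) \<theta>) (pd (1, 0) \<theta>) p = 0"
begin

lemma holo_hess: "holo_on (hess \<theta> A B) M"
  unfolding hess_def by (intro holo_on_pd M holo)

lemma hess_sym: "p \<in> M \<Longrightarrow> hess \<theta> 1 0 p = hess \<theta> 0 1 p"
  unfolding hess_def by (rule pd_commute[OF M holo])

lemma pd_hess_sym: "p \<in> M \<Longrightarrow> pd a (hess \<theta> 1 0) p = pd a (hess \<theta> 0 1) p"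
  by (rule pd_cong[OF M _ hess_sym])

text \<open>Third derivatives can be written in several ways; this and the next two lemmas choose a
  normal form that moves \<open>\<partial>\<^sub>0\<^sub>0\<close> outwards in place of
  \<open>\<partial>\<^sub>1\<^sub>0\<close>.\<close>

lemma pd_hess_rot: "p \<in> M \<Longrightarrow> pd a (hess \<theta> B C) p = pd (B, 0) (pd a (pd (C, 0) \<theta>)) p"
  unfolding hess_def by (rule pd_commute[OF M holo_on_pd[OF M holo]])

lemma pd_hess_100: "p \<in> M \<Longrightarrow> pd (1, 0) (hess \<theta> 0 0) p = pd (0, 0) (hess \<theta> 0 1) p"
  by (simp only: pd_hess_rot[of p "(1, 0)"]) (simp add: pd_hess_sym flip: hess_def)

lemma pd_hess_101: "p \<in> M \<Longrightarrow> pd (1, 0) (hess \<theta> 0 1) p = pd (0, 0) (hess \<theta> 1 1) p"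
  by (simp only: pd_hess_rot[of p "(1, 0)"]) (simp add: pd_hess_sym flip: hess_def)

text \<open>The heavenly equation differentiated along \<open>\<partial>\<^sub>D\<^sub>0\<close>,
  solved for the term with \<open>\<partial>\<^sub>1\<^sub>1\<close>.\<close>

lemma pd_heavenly:
  assumes "p \<in> M"
  shows "pd (1, 1) (hess \<theta> D 0) p = pd (0, 1) (hess \<theta> D 1) p 
     - pd (D, 0) (hess \<theta> 0 0) p * hess \<theta> 1 1 p - hess \<theta> 0 0 p * pd (D, 0) (hess \<theta> 1 1) p
     + 2 * hess \<theta> 0 1 p * pd (D, 0) (hess \<theta> 0 1) p"
proof -
  note h = holo_on_pd[OF M holo_on_pd[OF M holo]] holo_hess
  have "pd (1, 1) (pd (0, 0) \<theta>) q = pd (0, 1) (pd (1, 0) \<theta>) q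
     - hess \<theta> 0 0 q * hess \<theta> 1 1 q + hess \<theta> 0 1 q * hess \<theta> 0 1 q" if "q \<in> M" for q
    using heavenly[OF that] hess_sym[OF that]
    by (simp add: poisson_yx_def dX_def dY_def algebra_simps flip: hess_def)
  then have "pd (D, 0) (pd (1, 1) (pd (0, 0) \<theta>)) p = pd (D, 0) (\<lambda>q. pd (0, 1) (pd (1, 0) \<theta>) q
     - hess \<theta> 0 0 q * hess \<theta> 1 1 q + hess \<theta> 0 1 q * hess \<theta> 0 1 q) p"
    by (rule pd_cong[OF M assms])
  also have "\<dots> = pd (D, 0) (pd (0, 1) (pd (1, 0) \<theta>)) p 
     - pd (D, 0) (hess \<theta> 0 0) p * hess \<theta> 1 1 p - hess \<theta> 0 0 p * pd (D, 0) (hess \<theta> 1 1) p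
     + 2 * hess \<theta> 0 1 p * pd (D, 0) (hess \<theta> 0 1) p"
    using assms by (simp add: pd_simps[where U = M] h holo_intros algebra_simps)
  finally show ?thesis by (simp only: pd_hess_rot[OF assms])
qed

lemma pd_hamil: "p \<in> M \<Longrightarrow> pd a (hamil \<theta> A C) p = (if C = 0 then pd a (hess \<theta> 1 A) p else - pd a (hess \<theta> 0 A) p)"
  using pd_minus[OF holo_hess, of p a] by (simp add: hamil_def[abs_def])

text \<open>The case \<open>D = 1\<close> restated for rewriting, because
  \<open>hess \<theta> 1 0\<close> is normalised to \<open>hess \<theta> 0 1\<close>.\<close>

lemma pd_heavenly_1:
  assumes "p \<in> M"
  shows "pd (1, 1) (hess \<theta> 0 1) p = pd (0, 1) (hess \<theta> 1 1) p 
     - pd (0, 0) (hess \<theta> 0 1) p * hess \<theta> 1 1 p - hess \<theta> 0 0 p * pd (1, 0) (hess \<theta> 1 1) p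
     + 2 * hess \<theta> 0 1 p * pd (0, 0) (hess \<theta> 1 1) p"
  using pd_heavenly[OF assms, of 1] assms by (simp add: pd_hess_sym pd_hess_100 pd_hess_101)

lemmas third_simps = hess_sym pd_hess_sym pd_hess_100 pd_hess_101 pd_heavenly pd_heavenly_1

lemma pd_metric_matrix:
  assumes "p \<in> M"
  shows "pd a (\<lambda>q. metric_matrix (heavenly_metric \<theta>) q $ (A, i) $ (B, j)) p =
     (if i = 0 \<or> j = 0 then 0 else - 2 * pd a (hess \<theta> A B) p)"
  using assms two_cases[of i] two_cases[of j] two_cases[of A] two_cases[of B] unfolding metric_matrix_heavenly 
  by (auto simp: pd_cmult[where U = M] holo_hess pd_minus[where U = M] holo_intros pd_hess_sym)

lemma pd_tetrad:
  assumes "p \<in> M"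
  shows "pd a (\<lambda>q. heavenly_tetrad \<theta> B B' q $ (C, i)) p =
     (if B' \<noteq> 0 \<and> i = 0 then pd a (hamil \<theta> B C) p else 0)"
  using two_cases[of i] unfolding heavenly_tetrad_nth by (cases "C = B"; cases "B' = 0") auto

lemma christoffel_lower:
  assumes "p \<in> M"
  shows "christoffel (heavenly_metric \<theta>) p c a b =
     (\<Sum>d\<in>UNIV. inverse_metric \<theta> p $ c $ d *
        ((pd a (\<lambda>q. metric_matrix (heavenly_metric \<theta>) q $ d $ b) p
         + pd b (\<lambda>q. metric_matrix (heavenly_metric \<theta>) q $ d $ a) p
         - pd d (\<lambda>q. metric_matrix (heavenly_metric \<theta>) q $ a $ b) p) / 2))"
  unfolding christoffel_def matrix_inv_heavenly by (simp add: sum_divide_distrib)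

lemma christoffel_00: "p \<in> M \<Longrightarrow> christoffel (heavenly_metric \<theta>) p c (A, 0) (B, 0) = 0"
  by (simp add: christoffel_lower sum_coords pd_metric_matrix)

lemma christoffel_01: 
  assumes "p \<in> M"
  shows "christoffel (heavenly_metric \<theta>) p (C, k) (A, 0) (B, 1) = (if k = 0 then - pd (A, 0) (hamil \<theta> B C) p else 0)"
  using assms two_cases[of C] two_cases[of k]
  by (auto simp: christoffel_lower sum_coords pd_metric_matrix pd_hamil inverse_metric_def)

lemma christoffel_10: 
  assumes "p \<in> M"
  shows "christoffel (heavenly_metric \<theta>) p (C, k) (B, 1) (A, 0) = (if k = 0 then - pd (A, 0) (hamil \<theta> B C) p else 0)"
  using assms two_cases[of C] two_cases[of k]
  by (auto simp: christoffel_lower sum_coords pd_metric_matrix pd_hamil inverse_metric_def)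

lemma christoffel_11:
  assumes "p \<in> M"
  shows "christoffel (heavenly_metric \<theta>) p c (A, 1) (B, 1) =
     (\<Sum>D\<in>UNIV. inverse_metric \<theta> p $ c $ (D, 0) * pd (D, 0) (hess \<theta> A B) p
       + inverse_metric \<theta> p $ c $ (D, 1) * 
          (pd (D, 1) (hess \<theta> A B) p - pd (A, 1) (hess \<theta> D B) p - pd (B, 1) (hess \<theta> D A) p))"
  using assms by (simp add: christoffel_lower sum_coords sum_two pd_metric_matrix field_simps)

text \<open>The primed index \<open>B'\<close> is inert: only unprimed indices are rotated, which
  exhibits the flat primed connection in this frame.\<close>

lemma levi_civita_heavenly:
  assumes p: "p \<in> M"
  shows "levi_civita (heavenly_metric \<theta>) (heavenly_tetrad \<theta> A A') (heavenly_tetrad \<theta> B B') p =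
    (\<Sum>C\<in>UNIV. (if A' = 0 then 0 else - pd (B, 0) (hamil \<theta> A C) p) *s heavenly_tetrad \<theta> C B' p)"
proof -
  have "levi_civita (heavenly_metric \<theta>) (heavenly_tetrad \<theta> A A') (heavenly_tetrad \<theta> B B') p $ (D, k) =
    (\<Sum>C\<in>UNIV. (if A' = 0 then 0 else - pd (B, 0) (hamil \<theta> A C) p) *s heavenly_tetrad \<theta> C B' p) $ (D, k)" for D k
    using two_cases[of A] two_cases[of A'] two_cases[of B] two_cases[of B'] two_cases[of D] two_cases[of k]
    \<comment> \<open>There are 64 components; \<open>third_simps\<close>, including the
      differentiated heavenly equation, brings their third derivatives to normal form.\<close>
    apply (elim disjE)
    apply (simp_all add: p levi_civita_def sum_coords sum_two christoffel_00 christoffel_01 christoffel_10 christoffel_11 pd_tetrad heavenly_tetrad_nth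
       pd_hamil)
    apply (simp_all add: p hamil_def inverse_metric_def third_simps algebra_simps)
    done
  then show ?thesis by (simp add: vec_eq_iff)
qed

end

section \<open>The Killing spinor\<close>

text \<open>Composition with the transposition of 0 and \<open>i\<close> shows that all positions
  have the same sum over permutations; summing over positions first gives a constant for each
  permutation.\<close>

lemma sum_permutations_first:
  fixes F :: "'a \<Rightarrow> complex"
  assumes "0 < m"
  shows "of_nat m * (\<Sum>s | s permutes {..<m}. F (L ! s 0)) = fact m * (\<Sum>i<m. F (L ! i))"
proof -
  let ?P = "{s. s permutes {..<m}}"
  have "(\<Sum>s\<in>?P. F (L ! s 0)) = (\<Sum>s\<in>?P. F (L ! s i))" if "i < m" for i
  proof -
    have "Transposition.transpose 0 i permutes {..<m}" using assms that by (intro permutes_swap_id) auto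
    from sum_permutations_compose_right[OF this, of "\<lambda>s. F (L ! s 0)"] show ?thesis by simp
  qed
  note shift = this
  have "of_nat m * (\<Sum>s\<in>?P. F (L ! s 0)) = (\<Sum>i<m. \<Sum>s\<in>?P. F (L ! s 0))"
    by simp
  also have "\<dots> = (\<Sum>i<m. \<Sum>s\<in>?P. F (L ! s i))"
    by (rule sum.cong[OF refl]) (rule shift, simp)
  also have "\<dots> = (\<Sum>s\<in>?P. \<Sum>i<m. F (L ! s i))" by (rule sum.swap)
  also have "\<dots> = (\<Sum>s\<in>?P. \<Sum>i<m. F (L ! i))"
    by (rule sum.cong[OF refl]) (simp add: sum.permute[of _ "{..<m}" "\<lambda>i. F (L ! i)"] o_def)
  also have "\<dots> = fact m * (\<Sum>i<m. F (L ! i))"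
    by (simp add: card_permutations)
  finally show ?thesis .
qed

lemma count_list_two: "count_list L 0 + count_list L 1 = length L" for L :: "2 list"
  using two_cases by (induction L) auto

lemma sum_nth_two:
  fixes L :: "2 list" and F :: "2 \<Rightarrow> complex"
  shows "(\<Sum>i<length L. F (L ! i)) = of_nat (count_list L 0) * F 0 + of_nat (count_list L 1) * F 1"
proof -
  have "(\<Sum>x\<leftarrow>L. F x) = of_nat (count_list L 0) * F 0 + of_nat (count_list L 1) * F 1"
    using two_cases by (induction L) (auto simp: algebra_simps)
  then show ?thesis by (simp add: sum_list_sum_nth atLeast0LessThan)
qed

context heavenly_space
begin

lemma null_tetrad: "p \<in> M \<Longrightarrow> heavenly_metric \<theta> p (heavenly_tetrad \<theta> A A' p) (heavenly_tetrad \<theta> B B' p) = eps A B * eps A' B'"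
  using heavenly_tetrad_null[of \<theta> p] hess_sym[of p] by (simp add: null_tetrad_at_def hess_def)

lemma heavenly_metric_lincomb:
  "heavenly_metric \<theta> p (x *s u + y *s v) w = x * heavenly_metric \<theta> p u w + y * heavenly_metric \<theta> p v w"
  by (simp add: heavenly_metric_def Let_def algebra_simps)

lemma tetrad_comp_frame:
  assumes "p \<in> M"
  shows "tetrad_comp (heavenly_metric \<theta>) (heavenly_tetrad \<theta>) p (\<Sum>C\<in>UNIV. x C *s heavenly_tetrad \<theta> C B' p) A A' =
     (if A' = B' then x A else 0)"
  using two_cases[of A] two_cases[of A'] two_cases[of B']
  by (auto simp: tetrad_comp_def heavenly_metric_lincomb null_tetrad assms sum_two)

lemma spin_conn_heavenly:
  assumes "p \<in> M"
  shows "spin_conn (heavenly_metric \<theta>) (heavenly_tetrad \<theta>) p A A' B C =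
     (if A' = 0 then 0 else - pd (B, 0) (hamil \<theta> A C) p)"
  unfolding spin_conn_def levi_civita_heavenly[OF assms] tetrad_comp_frame[OF assms] by simp

text \<open>Hamiltonian vector fields are divergence-free. This trace is what remains of the primed
  connection, and it is also what lets \<open>eps\<close> pass through the unprimed one.\<close>

lemma hamil_divergence_free:
  "p \<in> M \<Longrightarrow> pd (1, 0) (hamil \<theta> A 1) p = - pd (0, 0) (hamil \<theta> A 0) p"
  using two_cases[of A] by (auto simp: pd_hamil third_simps)

lemma spin_conn_primed_heavenly:
  assumes "p \<in> M"
  shows "spin_conn_primed (heavenly_metric \<theta>) (heavenly_tetrad \<theta>) p A A' B' C' = 0"
  unfolding spin_conn_primed_def levi_civita_heavenly[OF assms] tetrad_comp_frame[OF assms]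
  by (simp add: sum_two hamil_divergence_free assms)

lemma spinor_nabla_0:
  assumes "p \<in> M"
  shows "spinor_nabla (heavenly_metric \<theta>) (heavenly_tetrad \<theta>) \<kappa> p A 0 B L = pd (A, 0) (\<lambda>q. \<kappa> q B L) p"
  using two_cases[of A]
  by (auto simp: spinor_nabla_def spin_conn_primed_heavenly spin_conn_heavenly assms sum_coords heavenly_tetrad_nth)

lemma spinor_nabla_1:
  assumes "p \<in> M"
  shows "spinor_nabla (heavenly_metric \<theta>) (heavenly_tetrad \<theta>) \<kappa> p A 1 B L =
     pd (A, 1) (\<lambda>q. \<kappa> q B L) p + (\<Sum>C\<in>UNIV. hamil \<theta> A C p * pd (C, 0) (\<lambda>q. \<kappa> q B L) p)
     - (\<Sum>C\<in>UNIV. pd (C, 0) (hamil \<theta> A B) p * \<kappa> p C L)"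
  using two_cases[of A]
  by (auto simp: spinor_nabla_def spin_conn_primed_heavenly spin_conn_heavenly assms sum_coords sum_two heavenly_tetrad_nth)

end

text \<open>Permuting \<open>L\<close> preserves its number of ones, so a summand depends only on
  which index is moved to the front; each value of that index is weighted by its multiplicity in
  \<open>L\<close>.\<close>

lemma killing_op_by_counts:
  assumes L: "length L = m" "0 < m" 
    and G: "\<And>A B L'. length L' = m \<Longrightarrow> count_list L' 1 = count_list L 1 \<Longrightarrow> raised_nabla g e \<kappa> p A B L' = G A B (hd L')"
    and zero: "of_nat (count_list L 0) * (G A B 0 + G B A 0) + of_nat (count_list L 1) * (G A B 1 + G B A 1) = (0 :: complex)"
  shows "killing_op g e \<kappa> p A B L = 0"
proof -
  let ?F = "\<lambda>x. G A B x + G B A x"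
  have "raised_nabla g e \<kappa> p A B (permute_list s L) + raised_nabla g e \<kappa> p B A (permute_list s L) = ?F (L ! s 0)"
    if s: "s permutes {..<m}" for s
  proof -
    have "mset (permute_list s L) = mset L" using s L by simp
    then have "count_list (permute_list s L) 1 = count_list L 1" by (metis count_mset)
    moreover have "hd (permute_list s L) = L ! s 0"
      using s L by (subst hd_conv_nth) (auto simp: permute_list_nth simp flip: length_greater_0_conv)
    ultimately show ?thesis using G[of "permute_list s L"] L by simp
  qed
  then have "(\<Sum>s | s permutes {..<m}. raised_nabla g e \<kappa> p A B (permute_list s L) + raised_nabla g e \<kappa> p B A (permute_list s L))
     = (\<Sum>s | s permutes {..<m}. ?F (L ! s 0))" by (intro sum.cong) auto
  moreover have "of_nat m * (\<Sum>s | s permutes {..<m}. ?F (L ! s 0)) = 0"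
    using sum_permutations_first[OF L(2), of ?F L] sum_nth_two[of ?F L] zero L(1) by simp
  ultimately show ?thesis using L by (simp add: killing_op_def)
qed

section \<open>The spinor field on the slice\<close>

context symmetric_hierarchy
begin

lemma heavenly_slice: "heavenly_space (\<lambda>p. \<Theta> (slice_emb \<iota> c p)) (slice \<iota> c U)"
proof
  show "open (slice \<iota> c U)" by (rule open_slice[OF U])
  show "holo_on (\<lambda>p. \<Theta> (slice_emb \<iota> c p)) (slice \<iota> c U)" by (rule holo_on_slice[OF holo_Theta])
  fix p assume "p \<in> slice \<iota> c U"
  then have p: "slice_emb \<iota> c p \<in> U" by (simp add: slice_def)
  have "1 \<in> {1..n}" using n by simp
  then have "pd (0, \<iota> 1) (pd (1, \<iota> (1 - 1)) \<Theta>) (slice_emb \<iota> c p) - pd (1, \<iota> 1) (pd (0, \<iota> (1 - 1)) \<Theta>) (slice_emb \<iota> c p)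
        + poisson_yx (\<iota> 0) (pd (0, \<iota> (1 - 1)) \<Theta>) (pd (1, \<iota> (1 - 1)) \<Theta>) (slice_emb \<iota> c p) = 0"
    using sol p unfolding hierarchy_solution_def by blast
  then show "pd (0, 1) (pd (1, 0) (\<lambda>p. \<Theta> (slice_emb \<iota> c p))) p - pd (1, 1) (pd (0, 0) (\<lambda>p. \<Theta> (slice_emb \<iota> c p))) p
        + poisson_yx 0 (pd (0, 0) (\<lambda>p. \<Theta> (slice_emb \<iota> c p))) (pd (1, 0) (\<lambda>p. \<Theta> (slice_emb \<iota> c p))) p = 0"
    by (simp add: poisson_yx_def dX_def dY_def pd_slice[OF iota_01, abs_def])
qed

lemma hamil_slice: "hamil (\<lambda>p. \<Theta> (slice_emb \<iota> c p)) A C = (\<lambda>p. H A C (slice_emb \<iota> c p))"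
  by (cases "C = 0") (simp_all add: hamil_def[abs_def] hess_def twistor_hamil_def pd_slice[OF iota_01, abs_def])

text \<open>The coefficient of \<open>\<pi>\<^sub>0\<^sub>'\<^sup>j \<pi>\<^sub>1\<^sub>'\<^sup>2\<^sup>n\<^sup>-\<^sup>1\<^sup>-\<^sup>j\<close> in \<open>\<kappa>(\<pi>)\<close>, divided by the number of index lists with
  \<open>j\<close> ones; the sign comes from \<open>\<pi>\<^sup>0\<^sup>' = \<pi>\<^sub>1\<^sub>'\<close>, \<open>\<pi>\<^sup>1\<^sup>' = - \<pi>\<^sub>0\<^sub>'\<close>.\<close>

definition killing_coeff :: "complex ^ (2 \<times> 'm) \<Rightarrow> 2 \<Rightarrow> nat \<Rightarrow> point \<Rightarrow> complex" where
  "killing_coeff c B j p = (- 1) ^ j / of_nat (2 * n - 1 choose j) *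
     (\<Sum>D\<in>UNIV. eps B D * potential D (Suc j) (slice_emb \<iota> c p))"

text \<open>Only the number of ones in the list is used, which makes symmetry in the primed indices
  automatic.\<close>

definition killing_spinor :: "complex ^ (2 \<times> 'm) \<Rightarrow> spinor_field" where
  "killing_spinor c p B L = killing_coeff c B (count_list L 1) p"

lemma holo_killing_coeff: "holo_on (killing_coeff c B j) (slice \<iota> c U)"
  unfolding killing_coeff_def[abs_def] by (intro holo_intros holo_on_slice holo_potential)

lemma sym_spinor_field_killing_spinor: "sym_spinor_field (slice \<iota> c U) m (killing_spinor c)"
  unfolding sym_spinor_field_def killing_spinor_def
proof (intro conjI allI impI ballI)
  fix B and L :: "2 list" assume "length L = m"
  show "holo_on (\<lambda>p. killing_coeff c B (count_list L 1) p) (slice \<iota> c U)"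
    using holo_killing_coeff .
next
  fix p B and L :: "2 list" and s assume "length L = m \<and> s permutes {..<m}"
  then have "mset (permute_list s L) = mset L" by simp
  then show "killing_coeff c B (count_list (permute_list s L) 1) p = killing_coeff c B (count_list L 1) p"
    by (metis count_mset)
qed

lemma pd_killing_coeff:
  assumes "p \<in> slice \<iota> c U"
  shows "pd (A, 0) (killing_coeff c B j) p = (- 1) ^ j / of_nat (2 * n - 1 choose j) *
     (\<Sum>D\<in>UNIV. eps B D * pd (A, \<iota> 0) (potential D (Suc j)) (slice_emb \<iota> c p))" (is ?g0)
   and "pd (A, 1) (killing_coeff c B j) p = (- 1) ^ j / of_nat (2 * n - 1 choose j) *
     (\<Sum>D\<in>UNIV. eps B D * pd (A, \<iota> 1) (potential D (Suc j)) (slice_emb \<iota> c p))" (is ?g1)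
proof -
  have "pd a (killing_coeff c B j) p = (- 1) ^ j / of_nat (2 * n - 1 choose j) *
     (\<Sum>D\<in>UNIV. eps B D * pd a (\<lambda>p. potential D (Suc j) (slice_emb \<iota> c p)) p)" for a
  proof -
    note h = holo_on_slice[OF holo_potential]
    have "pd a (\<lambda>p. \<Sum>D\<in>UNIV. eps B D * potential D (Suc j) (slice_emb \<iota> c p)) p
      = (\<Sum>D\<in>UNIV. eps B D * pd a (\<lambda>p. potential D (Suc j) (slice_emb \<iota> c p)) p)"
      using assms by (simp add: pd_cmult[OF h] pd_sum[where U = "slice \<iota> c U"] holo_intros h)
    moreover have "pd a (killing_coeff c B j) p = (- 1) ^ j / of_nat (2 * n - 1 choose j) *
        pd a (\<lambda>p. \<Sum>D\<in>UNIV. eps B D * potential D (Suc j) (slice_emb \<iota> c p)) p"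
      unfolding killing_coeff_def[abs_def] by (rule pd_cmult[OF _ assms]) (intro holo_intros h)
    ultimately show ?thesis by (simp only:)
  qed
  then show ?g0 ?g1 by (simp_all add: pd_slice[OF iota_01])
qed

text \<open>The covariant derivative along \<open>e\<^sub>C\<^sub>1\<^sub>'\<close> of the
  potential, regarded as a spinor with lower index \<open>D\<close>.\<close>

definition frame_derivative :: "2 \<Rightarrow> 2 \<Rightarrow> nat \<Rightarrow> complex ^ (2 \<times> 'm) \<Rightarrow> complex" where
  "frame_derivative C D k q = E C q (\<lambda>b. pd b (potential D k) q)
     + (\<Sum>F\<in>UNIV. pd (D, \<iota> 0) (H C F) q * potential F k q)"

text \<open>The Killing equation between neighbouring coefficients: the symmetrised derivative along
  \<open>e\<^sub>C\<^sub>0\<^sub>'\<close> at order \<open>k + 1\<close> equals the one along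
  \<open>e\<^sub>C\<^sub>1\<^sub>'\<close> at order \<open>k\<close>.\<close>

lemma killing_recursion:
  assumes "q \<in> U" "k \<le> 2 * n"
  shows "pd (C, \<iota> 0) (potential D (Suc k)) q + pd (D, \<iota> 0) (potential C (Suc k)) q
     = frame_derivative C D k q + frame_derivative D C k q"
  using killing_term_antisym[OF assms, of C D] by (simp add: killing_term_def frame_derivative_def algebra_simps)

lemma pd_potential_0: "q \<in> U \<Longrightarrow> pd b (potential D 0) q = 0"
  using pd_cong[OF U, of q "potential D 0" "\<lambda>_. 0" b] by (simp add: potential_0)

lemma pd_potential_top: "q \<in> U \<Longrightarrow> pd b (potential D (Suc (2 * n))) q = 0"
  using pd_cong[OF U, of q "potential D (Suc (2 * n))" "\<lambda>_. 0" b] by (simp add: potential_top)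

lemma frame_derivative_0: "q \<in> U \<Longrightarrow> frame_derivative C D 0 q = 0"
  by (simp add: frame_derivative_def pd_potential_0 potential_0)

lemma spinor_nabla_killing_spinor:
  assumes p: "p \<in> slice \<iota> c U"
  defines "g \<equiv> heavenly_metric (\<lambda>p. \<Theta> (slice_emb \<iota> c p))" and "e \<equiv> heavenly_tetrad (\<lambda>p. \<Theta> (slice_emb \<iota> c p))"
  shows "spinor_nabla g e (killing_spinor c) p C 0 B L = (- 1) ^ count_list L 1 / of_nat (2 * n - 1 choose count_list L 1) *
     (\<Sum>D\<in>UNIV. eps B D * pd (C, \<iota> 0) (potential D (Suc (count_list L 1))) (slice_emb \<iota> c p))" (is ?g0)
    and "spinor_nabla g e (killing_spinor c) p C 1 B L = (- 1) ^ count_list L 1 / of_nat (2 * n - 1 choose count_list L 1) *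
     (\<Sum>D\<in>UNIV. eps B D * frame_derivative C D (Suc (count_list L 1)) (slice_emb \<iota> c p))" (is ?g1)
proof -
  interpret h: heavenly_space "\<lambda>p. \<Theta> (slice_emb \<iota> c p)" "slice \<iota> c U" by (rule heavenly_slice)
  have k: "(\<lambda>q. killing_spinor c q B L) = killing_coeff c B (count_list L 1)" for B L
    by (simp add: killing_spinor_def fun_eq_iff)
  show ?g0
    unfolding g_def e_def h.spinor_nabla_0[OF p] k by (rule pd_killing_coeff(1)[OF p])
  \<comment> \<open>A trace-free connection preserves \<open>eps\<close>; this converts the
    connection term for the raised index into the one for the lowered index.\<close>
  have div: "pd (1, \<iota> 0) (H C 1) (slice_emb \<iota> c p) = - pd (0, \<iota> 0) (H C 0) (slice_emb \<iota> c p)"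
    using h.hamil_divergence_free[OF p, of C] by (simp add: hamil_slice pd_slice[OF iota_01])
  define a where "a = (- 1) ^ count_list L 1 / (of_nat (2 * n - 1 choose count_list L 1) :: complex)"
  show ?g1
    unfolding g_def e_def h.spinor_nabla_1[OF p] k
    unfolding pd_killing_coeff[OF p] hamil_slice pd_slice[OF iota_01]
    unfolding killing_spinor_def killing_coeff_def a_def[symmetric]
    using two_cases[of B] 
    by (auto simp: sum_two frame_derivative_def contract_frame_def div algebra_simps)
qed

text \<open>Let \<open>L\<close> have \<open>j\<close> ones. A leading 0 leaves \<open>j\<close>
  ones in the tail and a leading 1 leaves \<open>j - 1\<close>. By \<open>killing_recursion\<close>
  both contributions are multiples of one quantity \<open>T\<close>, and the signs and binomials in
  \<open>killing_coeff\<close> make their weighted sum zero.\<close>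

lemma killing_op_killing_spinor:
  assumes p: "p \<in> slice \<iota> c U" and L: "length L = 2 * n"
  defines "g \<equiv> heavenly_metric (\<lambda>p. \<Theta> (slice_emb \<iota> c p))" and "e \<equiv> heavenly_tetrad (\<lambda>p. \<Theta> (slice_emb \<iota> c p))"
  shows "killing_op g e (killing_spinor c) p A B L = 0"
proof -
  let ?q = "slice_emb \<iota> c p"
  have q: "?q \<in> U" using p by (simp add: slice_def)
  define j where "j = count_list L 1"
  have j: "j \<le> 2 * n" "count_list L 0 = 2 * n - j" using count_list_two[of L] L by (auto simp: j_def)
  define a where "a i = (- 1) ^ i / (of_nat (2 * n - 1 choose i) :: complex)" for i
  \<comment> \<open>For \<open>j > 0\<close> the order \<open>Suc (j - 1)\<close> is
    \<open>j\<close>; for \<open>j = 0\<close> this branch later receives weight 0.\<close>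
  define G where "G A B x = (if x = 0 
     then a j * (\<Sum>C\<in>UNIV. eps A C * (\<Sum>D\<in>UNIV. eps B D * pd (C, \<iota> 0) (potential D (Suc j)) ?q))
     else a (j - 1) * (\<Sum>C\<in>UNIV. eps A C * (\<Sum>D\<in>UNIV. eps B D * frame_derivative C D (Suc (j - 1)) ?q)))" for A B :: 2 and x :: 2
  define T where "T = (\<Sum>C\<in>UNIV. \<Sum>D\<in>UNIV. eps A C * eps B D * (frame_derivative C D j ?q + frame_derivative D C j ?q))"
  have T0: "(\<Sum>C\<in>UNIV. eps A C * (\<Sum>D\<in>UNIV. eps B D * pd (C, \<iota> 0) (potential D (Suc j)) ?q))
     + (\<Sum>C\<in>UNIV. eps B C * (\<Sum>D\<in>UNIV. eps A D * pd (C, \<iota> 0) (potential D (Suc j)) ?q)) = T"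
    unfolding T_def killing_recursion[OF q j(1), symmetric] by (simp add: sum_two algebra_simps)
  have T1: "(\<Sum>C\<in>UNIV. eps A C * (\<Sum>D\<in>UNIV. eps B D * frame_derivative C D j ?q))
     + (\<Sum>C\<in>UNIV. eps B C * (\<Sum>D\<in>UNIV. eps A D * frame_derivative C D j ?q)) = T"
    unfolding T_def by (simp add: sum_two algebra_simps)
  have G0: "G A B 0 + G B A 0 = a j * T"
    unfolding T0[symmetric] by (simp add: G_def distrib_left)
  have G1: "G A B 1 + G B A 1 = a (j - 1) * T" if "j > 0"
    unfolding T1[symmetric] using that by (simp add: G_def distrib_left)
  show ?thesis
  proof (rule killing_op_by_counts[OF L, where G = G])
    show "0 < 2 * n" using n by simp
    fix A B and L' :: "2 list" assume L': "length L' = 2 * n" "count_list L' 1 = count_list L 1"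
    then obtain x M where M: "L' = x # M" using n by (cases L') auto
    then have "count_list M 1 = (if x = 0 then j else j - 1)" 
      using L'(2) two_cases[of x] by (auto simp: j_def)
    then show "raised_nabla g e (killing_spinor c) p A B L' = G A B (hd L')"
      using two_cases[of x] unfolding g_def e_def
      by (auto simp: raised_nabla_def M spinor_nabla_killing_spinor[OF p] G_def a_def sum_two algebra_simps)
  next
    have "of_nat (2 * n - j) * (a j * T) + of_nat j * (G A B 1 + G B A 1) = 0"
    proof -
      \<comment> \<open>In both extreme cases \<open>T\<close> is zero, because the potentials of
        orders 0 and \<open>2 * n + 1\<close> vanish. At \<open>j = 2 * n\<close> the binomial in
        \<open>a j\<close> is 0, so that \<open>a j\<close> is a division by zero.\<close>
      consider "j = 0" | "j = 2 * n" | "0 < j" "j < 2 * n" using j(1) by linarith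
      then show ?thesis
      proof cases
        case 1
        then have "T = 0" by (simp add: T_def frame_derivative_0[OF q])
        with 1 show ?thesis by simp
      next
        case 2
        then have "T = 0" unfolding T0[symmetric] by (simp add: pd_potential_top[OF q])
        with 2 n G1 show ?thesis by simp
      next
        case 3
        then obtain i where i: "j = Suc i" by (cases j) auto
        have "(2 * n - 1 choose j) * j = (2 * n - 1 choose i) * (2 * n - j)"
          using binomial_absorption[of i "2 * n - 1"] binomial_absorb_comp[of "2 * n - 1" i] i
          by (simp add: mult.commute)
        then have "of_nat (2 * n - 1 choose j) * of_nat j = (of_nat (2 * n - 1 choose i) * of_nat (2 * n - j) :: complex)"
          unfolding of_nat_mult[symmetric] by simp
        moreover have "(of_nat (2 * n - 1 choose j) :: complex) \<noteq> 0" "(of_nat (2 * n - 1 choose i) :: complex) \<noteq> 0"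
          using 3 i by auto
        moreover have "v * (- s / x) + u * (s / y) = 0" if "x * u = y * v" "x \<noteq> 0" "y \<noteq> 0" for x y u v s :: complex
          using that by (simp add: field_simps)
        ultimately have "of_nat (2 * n - j) * (- ((- 1) ^ i) / of_nat (2 * n - 1 choose j)) 
            + of_nat j * ((- 1) ^ i / of_nat (2 * n - 1 choose i)) = (0 :: complex)"
          by blast
        then have "of_nat (2 * n - j) * a j + of_nat j * a (j - 1) = 0"
          by (simp add: a_def i)
        then have "(of_nat (2 * n - j) * a j + of_nat j * a (j - 1)) * T = 0" by simp
        with G1 3 show ?thesis by (simp add: algebra_simps)
      qed
    qed
    then show "of_nat (count_list L 0) * (G A B 0 + G B A 0) + of_nat (count_list L 1) * (G A B 1 + G B A 1) = 0"
      unfolding G0 j(2) j_def[symmetric] .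
  qed
qed

end

theorem proposition4p1:
  fixes n :: nat and \<iota> :: "nat \<Rightarrow> 'm::finite"
    and U :: "(complex ^ (2 \<times> 'm)) set" and \<Theta> :: "complex ^ (2 \<times> 'm) \<Rightarrow> complex"
    and K :: "complex ^ (2 \<times> 'm) \<Rightarrow> complex ^ (2 \<times> 'm)"
    and c :: "complex ^ (2 \<times> 'm)" and M :: "point set"
    and \<theta> :: "point \<Rightarrow> complex" and g :: metric and e :: tetrad
  assumes "n \<ge> 1" and "bij_betw \<iota> {0..n} UNIV"
    and "open U" and "connected U"
    and "hierarchy_solution n \<iota> U \<Theta>"
    and "hierarchy_symmetry n \<iota> U \<Theta> K" and "\<exists>p\<in>U. K p \<noteq> 0"
    and "M = slice \<iota> c U" and "M \<noteq> {}"
    and "\<theta> = (\<lambda>p. \<Theta> (slice_emb \<iota> c p))"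
    and "g = heavenly_metric \<theta>" and "e = heavenly_tetrad \<theta>"
  shows "\<exists>\<kappa>. sym_spinor_field M (2 * n - 1) \<kappa>
           \<and> (\<exists>p\<in>M. \<exists>B L. length L = 2 * n - 1 \<and> \<kappa> p B L \<noteq> 0)
           \<and> (\<forall>p\<in>M. \<forall>A B L. length L = 2 * n \<longrightarrow> killing_op g e \<kappa> p A B L = 0)"
proof -
  from assms(6) obtain \<phi> where \<phi>: "\<And>c. holo_on (\<lambda>p. K p $ c) U" "\<And>A' B'. holo_on (\<lambda>p. \<phi> p A' B') U"
    "\<And>p \<pi> a b. p \<in> U \<Longrightarrow> lie_lift_Sigma n \<iota> \<Theta> K \<phi> \<pi> p a b = 0"
    unfolding hierarchy_symmetry_def by blast
  have "hierarchy n \<iota> U \<Theta>" by (rule hierarchy.intro) fact+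
  moreover have "symmetric_hierarchy_axioms n \<iota> U \<Theta> K \<phi>"
    using \<phi> by (rule symmetric_hierarchy_axioms.intro)
  ultimately interpret symmetric_hierarchy n \<iota> U \<Theta> K \<phi>
    by (rule symmetric_hierarchy.intro)
  have "slice \<iota> c U \<noteq> {}" using assms(8,9) by simp
  with assms(4,7) obtain p B k where p: "p \<in> slice \<iota> c U" and k: "k < 2 * n" and nz: "potential B (Suc k) (slice_emb \<iota> c p) \<noteq> 0"
    by (rule potential_nonzero_on_slice)
  \<comment> \<open>Of the lists of the required length, one with exactly \<open>k\<close> ones
    addresses the coefficient built from \<open>potential B (Suc k)\<close>.\<close>
  define L where "L = replicate k (1 :: 2) @ replicate (2 * n - 1 - k) 0"
  have L: "length L = 2 * n - 1" "count_list L 1 = k"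
    using k by (auto simp: L_def simp flip: count_mset)
  have "(2 * n - 1 choose k) \<noteq> 0" using k by auto
  \<comment> \<open>Raising with \<open>eps\<close> swaps the two components, so the non-zero
    potential of index \<open>B\<close> appears at \<open>1 - B\<close>.\<close>
  then have "killing_spinor c p (1 - B) L \<noteq> 0"
    using nz two_cases[of B] by (auto simp: killing_spinor_def killing_coeff_def L sum_two)
  with p L(1) have "\<exists>p\<in>M. \<exists>B L. length L = 2 * n - 1 \<and> killing_spinor c p B L \<noteq> 0"
    unfolding assms(8) by blast
  moreover have "\<forall>p\<in>M. \<forall>A B L. length L = 2 * n \<longrightarrow> killing_op g e (killing_spinor c) p A B L = 0"
    unfolding assms(8,10,11,12) using killing_op_killing_spinor by blast
  ultimately show ?thesis
    using sym_spinor_field_killing_spinor[of c "2 * n - 1"] unfolding assms(8) by blast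
qed

end
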